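(* Let $\mathcal{A}=\lambda/\mu$ be a skew diagram which decomposes into two disconnected pieces which are (translates of) the Young diagrams of nonempty partitions $\alpha$ and $\beta$. Then \[hl(\mathcal{A})=hl(\alpha)+hl(\beta)=\pi_{nw}(\mathcal{A}).\] Furthermore, there are exactly $2^{\min(d(\alpha),d(\beta))}$ partitions $\nu$ with $hl(\nu)=hl(\mathcal{A})$ and $[\nu]$ appearing in $[\mathcal{A}]$, and each of these $[\nu]$ appears in $[\mathcal{A}]$ with multiplicity $1$.
   Context: Partitions are identified with their Young diagrams in matrix coordinates (box $(i,j)$ is in row $i$, column $j$); $l(\lambda)$ is the number of nonzero parts; sums of partitions (or of finite sequences) are taken componentwise, padding with zeros. For $\mu\subseteq\lambda$ the skew diagram $\lambda/\mu$ is the set of boxes of $\lambda$ not in $\mu$; skew diagrams are regarded up to translation. $c(\lambda;\mu,\nu)$ denotes the Littlewood–Richardson coefficient, and the skew character of $S_n$ is $[\lambda/\mu]=\sum_\nu c(\lambda;\mu,\nu)[\nu]$, where $[\nu]$ is the irreducible character labelled by $\nu$; $[\nu]$ appears in $[\mathcal{A}]$ iff its coefficient (its multiplicity) is nonzero. When $\lambda/\mu$ decomposes into disconnected pieces of shapes $\alpha,\beta$ one has $[\lambda/\mu]=\sum_\nu c(\nu;\alpha,\beta)[\nu]$. A skew diagram decomposes into disconnected diagrams $\mathcal{B},\mathcal{C}$ if no box of $\mathcal{B}$ lies in the same row or column as a box of $\mathcal{C}$. Northwest ribbons: for a skew diagram $\mathcal{A}$, $nw_1(\mathcal{A})$ is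 the set of boxes $(i,j)\in\mathcal{A}$ with $(i-1,j-1)\notin\mathcal{A}$ (for connected $\mathcal{A}$ this is the ribbon running along the northwest border from the lowest box of the leftmost column to the rightmost box of the top row; for disconnected $\mathcal{A}$ it is the union of the $nw_1$ of the components), and $nw_{k+1}(\mathcal{A})=nw_1$ of the diagram obtained from $\mathcal{A}$ by removing $nw_1(\mathcal{A}),\dots,nw_k(\mathcal{A})$. The northwest ribbon length partition is $\pi_{nw}(\mathcal{A})=(|nw_1(\mathcal{A})|,|nw_2(\mathcal{A})|,\dots)$. For a partition $\lambda$, $hl_i(\lambda)$ is the hook length of the box $(i,i)$ (zero if $(i,i)\notin\lambda$) and $hl(\lambda)=(hl_1(\lambda),hl_2(\lambda),\dots)$. For a skew diagram $\mathcal{A}$, $hl(\mathcal{A})$ is the lexicographically largest $hl(\nu)$ among all $\nu$ with $[\nu]$ appearing in $[\mathcal{A}]$. The Durfee size $d(\lambda)$ is the largest $d$ with $(d^d)\subseteq\lambda$. *)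

theory Defs
  imports Complex_Main "HOL-Library.FuncSet" "HOL-Library.Fun_Lexorder"
begin

text \<open>Partitions are weakly decreasing sequences with finitely many nonzero parts. Parts, rows,
  columns and tableau entries are all counted from 0, so that \<open>lam i\<close> is the length of row \<open>i\<close>
  and the entry \<open>k\<close> of a tableau is counted by the part \<open>nu k\<close> of its content.\<close>

definition is_partition :: "(nat \<Rightarrow> nat) \<Rightarrow> bool" where
  "is_partition lam \<longleftrightarrow> antimono lam \<and> finite {i. lam i \<noteq> 0}"

definition young_diagram :: "(nat \<Rightarrow> nat) \<Rightarrow> (nat \<times> nat) set" where
  "young_diagram lam = {(i, j). j < lam i}"

definition skew_diagram :: "(nat \<Rightarrow> nat) \<Rightarrow> (nat \<Rightarrow> nat) \<Rightarrow> (nat \<times> nat) set" where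
  "skew_diagram lam mu = young_diagram lam - young_diagram mu"

definition is_translate :: "(nat \<times> nat) set \<Rightarrow> (nat \<times> nat) set \<Rightarrow> bool" where
  "is_translate B D \<longleftrightarrow> (\<exists>a b. B = (\<lambda>(i, j). (i + a, j + b)) ` D)"

definition disconnected :: "(nat \<times> nat) set \<Rightarrow> (nat \<times> nat) set \<Rightarrow> bool" where
  "disconnected B C \<longleftrightarrow> (\<forall>(i, j) \<in> B. \<forall>(k, l) \<in> C. i \<noteq> k \<and> j \<noteq> l)"

definition semistandard :: "(nat \<times> nat) set \<Rightarrow> (nat \<times> nat \<Rightarrow> nat) \<Rightarrow> bool" where
  "semistandard A T \<longleftrightarrow>
     (\<forall>i j j'. (i, j) \<in> A \<and> (i, j') \<in> A \<and> j < j' \<longrightarrow> T (i, j) \<le> T (i, j')) \<and>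
     (\<forall>i i' j. (i, j) \<in> A \<and> (i', j) \<in> A \<and> i < i' \<longrightarrow> T (i, j) < T (i', j))"

text \<open>The tableau word reads the rows from top to bottom, each from right to left;
  \<open>read_upto A b\<close> is the set of boxes giving its initial segment that ends in box \<open>b\<close>.\<close>

definition read_upto :: "(nat \<times> nat) set \<Rightarrow> nat \<times> nat \<Rightarrow> (nat \<times> nat) set" where
  "read_upto A b = {(i, j) \<in> A. i < fst b \<or> (i = fst b \<and> snd b \<le> j)}"

definition lattice_filling :: "(nat \<times> nat) set \<Rightarrow> (nat \<times> nat \<Rightarrow> nat) \<Rightarrow> bool" where
  "lattice_filling A T \<longleftrightarrow>
     (\<forall>b \<in> A. \<forall>k. card {c \<in> read_upto A b. T c = Suc k} \<le> card {c \<in> read_upto A b. T c = k})"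

definition has_content :: "(nat \<times> nat) set \<Rightarrow> (nat \<times> nat \<Rightarrow> nat) \<Rightarrow> (nat \<Rightarrow> nat) \<Rightarrow> bool" where
  "has_content A T nu \<longleftrightarrow> (\<forall>k. card {c \<in> A. T c = k} = nu k)"

text \<open>The Littlewood-Richardson coefficient \<open>c(lam; mu, nu)\<close>. It is at the same time the
  multiplicity of the irreducible character \<open>[nu]\<close> in the skew character \<open>[lam/mu]\<close>, the latter
  being by definition the sum of all \<open>c(lam; mu, nu) [nu]\<close>. Fillings are extensional, so that
  each tableau is counted once.\<close>

definition LR_coeff :: "(nat \<Rightarrow> nat) \<Rightarrow> (nat \<Rightarrow> nat) \<Rightarrow> (nat \<Rightarrow> nat) \<Rightarrow> nat" where
  "LR_coeff lam mu nu =
     card {T \<in> extensional (skew_diagram lam mu).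
             semistandard (skew_diagram lam mu) T \<and>
             lattice_filling (skew_diagram lam mu) T \<and>
             has_content (skew_diagram lam mu) T nu}"

definition appears_in_skew :: "(nat \<Rightarrow> nat) \<Rightarrow> (nat \<Rightarrow> nat) \<Rightarrow> (nat \<Rightarrow> nat) \<Rightarrow> bool" where
  "appears_in_skew lam mu nu \<longleftrightarrow> is_partition nu \<and> LR_coeff lam mu nu \<noteq> 0"

definition nw_ribbon :: "(nat \<times> nat) set \<Rightarrow> (nat \<times> nat) set" where
  "nw_ribbon A = {(i, j) \<in> A. i = 0 \<or> j = 0 \<or> (i - 1, j - 1) \<notin> A}"

text \<open>The diagram left after removing the first \<open>k\<close> northwest ribbons.\<close>

primrec nw_rest :: "(nat \<times> nat) set \<Rightarrow> nat \<Rightarrow> (nat \<times> nat) set" where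
  "nw_rest A 0 = A"
| "nw_rest A (Suc k) = nw_rest A k - nw_ribbon (nw_rest A k)"

definition pi_nw :: "(nat \<times> nat) set \<Rightarrow> nat \<Rightarrow> nat" where
  "pi_nw A k = card (nw_ribbon (nw_rest A k))"

definition hook :: "(nat \<Rightarrow> nat) \<Rightarrow> nat \<times> nat \<Rightarrow> (nat \<times> nat) set" where
  "hook lam b =
     {(i, j) \<in> young_diagram lam. (i = fst b \<and> snd b \<le> j) \<or> (j = snd b \<and> fst b \<le> i)}"

definition hl :: "(nat \<Rightarrow> nat) \<Rightarrow> nat \<Rightarrow> nat" where
  "hl lam i = (if (i, i) \<in> young_diagram lam then card (hook lam (i, i)) else 0)"

text \<open>The lexicographically largest \<open>hl nu\<close>; the library's \<open>less_fun\<close> is the strict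
  lexicographic order on sequences.\<close>

definition hl_skew :: "(nat \<Rightarrow> nat) \<Rightarrow> (nat \<Rightarrow> nat) \<Rightarrow> nat \<Rightarrow> nat" where
  "hl_skew lam mu =
     (THE h. h \<in> hl ` {nu. appears_in_skew lam mu nu} \<and>
             (\<forall>h' \<in> hl ` {nu. appears_in_skew lam mu nu}. h' = h \<or> less_fun h' h))"

definition durfee :: "(nat \<Rightarrow> nat) \<Rightarrow> nat" where
  "durfee lam = (GREATEST d. {..<d} \<times> {..<d} \<subseteq> young_diagram lam)"

end

theory Submission imports Defs begin

text \<open>Let \<open>\<alpha>\<close> be the upper piece. A Littlewood-Richardson filling is forced on \<open>\<alpha>\<close> (row \<open>i\<close> is
  constantly \<open>i\<close>), so what remains is a semistandard filling \<open>T\<close> of \<open>\<beta>\<close> whose reading word keeps \<open>\<alpha>\<close>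
  plus the running content a partition; the final content is \<open>\<nu>\<close>. Entries in row \<open>i\<close> of \<open>\<beta>\<close> are at
  most \<open>l(\<alpha>) + i\<close>, and one less if the first row of \<open>\<beta>\<close> is constantly 0. Hence
  \<open>\<nu>\<^sub>0 + l(\<nu>) - 1 \<le> hl\<^sub>0(\<alpha>) + hl\<^sub>0(\<beta>)\<close>, and equality forces the first row
  of \<open>\<beta>\<close> (all 0, or all 0 but a final \<open>l(\<alpha>)\<close>) and the last entry of every other row. Deleting the
  first row and the row ends of such a \<open>T\<close> and lowering the other entries by 1 gives an arbitrary
  filling of the same kind for \<open>\<alpha>\<close>, \<open>\<beta>\<close>, \<open>\<nu>\<close> without their first rows and columns. So each diagonal
  box that \<open>\<alpha>\<close> and \<open>\<beta>\<close> share contributes exactly one binary choice, which is visible in \<open>\<nu>\<close>.\<close>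

subsection \<open>Partitions and diagonal hooks\<close>

definition part_length :: "(nat \<Rightarrow> nat) \<Rightarrow> nat" where
  "part_length lam = card {i. lam i \<noteq> 0}"

text \<open>The diagram without its first row and first column, moved back to the origin; truncated
  subtraction keeps empty rows empty. It drives the induction over the diagonal boxes.\<close>

definition peel :: "(nat \<Rightarrow> nat) \<Rightarrow> nat \<Rightarrow> nat" where
  "peel lam i = lam (Suc i) - 1"

definition shift_set :: "nat \<Rightarrow> nat \<Rightarrow> (nat \<times> nat) set \<Rightarrow> (nat \<times> nat) set" where
  "shift_set a b D = (\<lambda>(i, j). (i + a, j + b)) ` D"

lemma mem_young_diagram [simp]: "(i, j) \<in> young_diagram lam \<longleftrightarrow> j < lam i"
  by (simp add: young_diagram_def)

lemma partition_antimonoD: "is_partition lam \<Longrightarrow> i \<le> j \<Longrightarrow> lam j \<le> lam i"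
  by (auto simp: is_partition_def antimono_def)

text \<open>By monotonicity the support is an initial segment, so its cardinality is also its
  exclusive bound.\<close>

lemma part_length_iff:
  assumes "is_partition lam"
  shows "lam i \<noteq> 0 \<longleftrightarrow> i < part_length lam"
proof -
  let ?S = "{i. lam i \<noteq> 0}"
  have fin: "finite ?S" using assms by (simp add: is_partition_def)
  have down: "i \<in> ?S" if "j \<in> ?S" "i \<le> j" for i j
    using partition_antimonoD[OF assms that(2)] that(1) by auto
  have "i \<in> ?S" if "i < card ?S"
  proof (rule ccontr)
    assume "i \<notin> ?S"
    then have "?S \<subseteq> {..<i}" using down by (meson lessThan_iff not_le subsetI)
    then have "card ?S \<le> i" using card_mono[of "{..<i}" ?S] by simp
    with that show False by simp
  qed
  moreover have "i < card ?S" if "i \<in> ?S"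
  proof -
    have "{..i} \<subseteq> ?S" using down that by auto
    then have "card {..i} \<le> card ?S" using fin by (intro card_mono)
    then show ?thesis by simp
  qed
  ultimately show ?thesis by (auto simp: part_length_def)
qed

lemma part_length_eqI:
  assumes "\<And>i. lam i \<noteq> 0 \<longleftrightarrow> i < n"
  shows "part_length lam = n"
proof -
  have "{i. lam i \<noteq> 0} = {..<n}" using assms by auto
  then show ?thesis by (simp add: part_length_def)
qed

lemma part_length_pos: "is_partition lam \<Longrightarrow> 0 < lam 0 \<Longrightarrow> 0 < part_length lam"
  using part_length_iff[of lam 0] by simp

lemma finite_young_diagram:
  assumes "is_partition lam"
  shows "finite (young_diagram lam)"
proof (rule finite_subset)
  show "young_diagram lam \<subseteq> {..<part_length lam} \<times> {..<lam 0}"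
  proof
    fix x assume "x \<in> young_diagram lam"
    then obtain i j where x: "x = (i, j)" "j < lam i" by (cases x) auto
    have "lam i \<le> lam 0" using partition_antimonoD[OF assms] by simp
    then show "x \<in> {..<part_length lam} \<times> {..<lam 0}"
      using x part_length_iff[OF assms, of i] by auto
  qed
qed simp

lemma young_diagram_row: "(i, j) \<in> young_diagram lam \<Longrightarrow> is_partition lam \<Longrightarrow> i < part_length lam"
  using part_length_iff[of lam i] by auto

lemma peel_partition:
  assumes "is_partition lam"
  shows "is_partition (peel lam)"
proof -
  have "antimono (peel lam)"
    unfolding antimono_def peel_def
    using partition_antimonoD[OF assms] by (auto intro!: diff_le_mono)
  moreover have "{i. peel lam i \<noteq> 0} \<subseteq> {..<part_length lam}"
  proof
    fix i assume "i \<in> {i. peel lam i \<noteq> 0}"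
    then have "lam (Suc i) \<noteq> 0" by (auto simp: peel_def)
    then show "i \<in> {..<part_length lam}" using part_length_iff[OF assms] by auto
  qed
  ultimately show ?thesis
    unfolding is_partition_def using finite_subset by blast
qed

lemma part_length_peel_less:
  assumes "is_partition lam" "0 < lam 0"
  shows "part_length (peel lam) < part_length lam"
proof (cases "part_length (peel lam)")
  case 0
  then show ?thesis using part_length_pos[OF assms] by simp
next
  case (Suc m)
  then have "peel lam m \<noteq> 0" using part_length_iff[OF peel_partition[OF assms(1)]] by simp
  then have "lam (Suc m) \<noteq> 0" by (auto simp: peel_def)
  then show ?thesis using part_length_iff[OF assms(1)] Suc by simp
qed

lemma hl_0:
  assumes "is_partition lam" "0 < lam 0"
  shows "hl lam 0 + 1 = lam 0 + part_length lam"
proof -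
  have "hook lam (0, 0) = Pair 0 ` {..<lam 0} \<union> (\<lambda>i. (i, 0)) ` {1..<part_length lam}"
    using assms part_length_iff[OF assms(1)] by (fastforce simp: hook_def image_iff)
  also have "card \<dots> = card (Pair (0::nat) ` {..<lam 0}) + card ((\<lambda>i. (i, 0::nat)) ` {1..<part_length lam})"
    by (intro card_Un_disjoint) auto
  also have "\<dots> = lam 0 + (part_length lam - 1)"
    by (subst (1 2) card_image) (auto simp: inj_on_def)
  finally show ?thesis
    using assms part_length_pos[OF assms] by (simp add: hl_def)
qed

text \<open>The hooks of the later diagonal boxes avoid the first row and column, so peeling merely
  shifts the sequence \<open>hl\<close> by one. This reduces lexicographic comparisons to the peeled
  shapes.\<close>

lemma hl_Suc: "hl lam (Suc i) = hl (peel lam) i"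
proof -
  have "hook lam (Suc i, Suc i) = (\<lambda>(x, y). (Suc x, Suc y)) ` hook (peel lam) (i, i)" (is "?L = ?f ` ?R")
  proof (intro equalityI subsetI)
    fix z assume z: "z \<in> ?L"
    then obtain x y where xy: "z = (Suc x, Suc y)"
      by (cases z; cases "fst z"; cases "snd z") (auto simp: hook_def)
    then have "(x, y) \<in> ?R" using z by (auto simp: hook_def peel_def)
    then show "z \<in> ?f ` ?R" using xy by force
  qed (auto simp: hook_def peel_def)
  moreover have "card (?f ` ?R) = card ?R"
    by (intro card_image) (auto simp: inj_on_def)
  moreover have "(Suc i, Suc i) \<in> young_diagram lam \<longleftrightarrow> (i, i) \<in> young_diagram (peel lam)"
    by (auto simp: peel_def)
  ultimately show ?thesis by (simp add: hl_def)
qed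

lemma hl_eq_0:
  assumes "is_partition lam" "lam 0 = 0"
  shows "hl lam i = 0"
  using partition_antimonoD[OF assms(1), of 0 i] assms(2) by (simp add: hl_def)

lemma durfee_eqI:
  assumes "\<And>d'. {..<d'} \<times> {..<d'} \<subseteq> young_diagram lam \<longleftrightarrow> d' \<le> d"
  shows "durfee lam = d"
  unfolding durfee_def using assms by (intro Greatest_equality) auto

lemma durfee_iff:
  assumes "is_partition lam"
  shows "{..<d} \<times> {..<d} \<subseteq> young_diagram lam \<longleftrightarrow> d \<le> durfee lam"
proof -
  let ?P = "\<lambda>d. {..<d} \<times> {..<d} \<subseteq> young_diagram lam"
  have bound: "d \<le> lam 0" if "?P d" for d
  proof (cases d)
    case (Suc m)
    then have "(0, m) \<in> young_diagram lam" using that by blast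
    then show ?thesis using Suc by simp
  qed simp
  have "?P (durfee lam)"
    unfolding durfee_def by (rule GreatestI_nat[of ?P 0 "lam 0"]) (use bound in auto)
  moreover have "d \<le> durfee lam" if "?P d"
    unfolding durfee_def by (rule Greatest_le_nat[of ?P d "lam 0"]) (use bound that in auto)
  ultimately show ?thesis by (meson Sigma_mono lessThan_subset_iff order_trans)
qed

lemma durfee_0: "lam 0 = 0 \<Longrightarrow> durfee lam = 0"
  by (rule durfee_eqI) (fastforce simp: subset_iff)

lemma durfee_peel:
  assumes "is_partition lam" "0 < lam 0"
  shows "durfee lam = Suc (durfee (peel lam))"
proof (rule durfee_eqI)
  fix d
  show "{..<d} \<times> {..<d} \<subseteq> young_diagram lam \<longleftrightarrow> d \<le> Suc (durfee (peel lam))"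
  proof (cases d)
    case (Suc m)
    have "{..<d} \<times> {..<d} \<subseteq> young_diagram lam \<longleftrightarrow> {..<m} \<times> {..<m} \<subseteq> young_diagram (peel lam)"
    proof
      assume "{..<d} \<times> {..<d} \<subseteq> young_diagram lam"
      then show "{..<m} \<times> {..<m} \<subseteq> young_diagram (peel lam)"
        using Suc by (fastforce simp: peel_def)
    next
      assume L: "{..<m} \<times> {..<m} \<subseteq> young_diagram (peel lam)"
      have inner: "Suc j < lam (Suc i)" if "i < m" "j < m" for i j
        using subsetD[OF L, of "(i, j)"] that by (simp add: peel_def)
      show "{..<d} \<times> {..<d} \<subseteq> young_diagram lam"
      proof (rule subrelI)
        fix i j assume "(i, j) \<in> {..<d} \<times> {..<d}"
        then have ij: "i \<le> m" "j \<le> m" using Suc by auto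
        have "j < lam i"
        proof (cases "m = 0")
          case True then show ?thesis using ij assms by simp
        next
          case False
          \<comment> \<open>The corner \<open>(m - 1, m - 1)\<close> of the peeled square already
            makes row \<open>m\<close>, and hence every row above it, longer than
            \<open>m\<close>.\<close>
          have "m < lam m" using inner[of "m - 1" "m - 1"] False by simp
          also have "\<dots> \<le> lam i" using partition_antimonoD[OF assms(1)] ij by simp
          finally show ?thesis using ij by simp
        qed
        then show "(i, j) \<in> young_diagram lam" by simp
      qed
    qed
    then show ?thesis using durfee_iff[OF peel_partition[OF assms(1)]] Suc by simp
  qed simp
qed

subsection \<open>Littlewood-Richardson fillings relative to a partition\<close>

definition count_upto :: "(nat \<times> nat) set \<Rightarrow> (nat \<times> nat \<Rightarrow> nat) \<Rightarrow> nat \<Rightarrow> nat \<Rightarrow> nat" where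
  "count_upto D T n k = card {x \<in> D. fst x < n \<and> T x = k}"

text \<open>\<open>LR_tab \<alpha> \<beta>\<close> is the lattice condition after a word of content \<open>\<alpha>\<close> has already been read. In
  row \<open>n\<close> every \<open>k + 1\<close> is read before every \<open>k\<close>, so it suffices to compare the letters \<open>k + 1\<close> up to
  row \<open>n\<close> with the letters \<open>k\<close> above it.\<close>

definition LR_tab :: "(nat \<Rightarrow> nat) \<Rightarrow> (nat \<Rightarrow> nat) \<Rightarrow> (nat \<times> nat \<Rightarrow> nat) \<Rightarrow> bool" where
  "LR_tab \<alpha> \<beta> T \<longleftrightarrow> T \<in> extensional (young_diagram \<beta>) \<and> semistandard (young_diagram \<beta>) T \<and>
     (\<forall>n k. \<alpha> (Suc k) + count_upto (young_diagram \<beta>) T (Suc n) (Suc k)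
            \<le> \<alpha> k + count_upto (young_diagram \<beta>) T n k)"

text \<open>The summand \<alpha> accounts for the forced filling of the upper piece, so this is the
  partition \<nu> itself.\<close>

definition content :: "(nat \<Rightarrow> nat) \<Rightarrow> (nat \<Rightarrow> nat) \<Rightarrow> (nat \<times> nat \<Rightarrow> nat) \<Rightarrow> nat \<Rightarrow> nat" where
  "content \<alpha> \<beta> T k = \<alpha> k + card {x \<in> young_diagram \<beta>. T x = k}"

lemma semistandard_rowD:
  "semistandard D T \<Longrightarrow> (i, j) \<in> D \<Longrightarrow> (i, j') \<in> D \<Longrightarrow> j \<le> j' \<Longrightarrow> T (i, j) \<le> T (i, j')"
  unfolding semistandard_def by (metis le_neq_implies_less order_refl)

lemma semistandard_colD:
  "semistandard D T \<Longrightarrow> (i, j) \<in> D \<Longrightarrow> (i', j) \<in> D \<Longrightarrow> i < i' \<Longrightarrow> T (i, j) < T (i', j)"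
  unfolding semistandard_def by blast

lemma semistandard_ge_row:
  assumes "semistandard (young_diagram \<beta>) T" "is_partition \<beta>" "(i, j) \<in> young_diagram \<beta>"
  shows "i \<le> T (i, j)"
  using assms(3)
proof (induction i)
  case (Suc i)
  have "(i, j) \<in> young_diagram \<beta>"
    using Suc.prems partition_antimonoD[OF assms(2), of i "Suc i"] by simp
  then show ?case using Suc semistandard_colD[OF assms(1), of i j "Suc i"] by fastforce
qed simp

lemma count_upto_pos:
  assumes "finite D" "x \<in> D" "fst x < n" "T x = k"
  shows "0 < count_upto D T n k"
proof -
  have "x \<in> {x \<in> D. fst x < n \<and> T x = k}" using assms by simp
  moreover have "finite {x \<in> D. fst x < n \<and> T x = k}" using assms(1) by simp
  ultimately show ?thesis unfolding count_upto_def card_gt_0_iff by blast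
qed

lemma count_upto_posD:
  "0 < count_upto D T n k \<Longrightarrow> \<exists>i j. (i, j) \<in> D \<and> i < n \<and> T (i, j) = k"
  unfolding count_upto_def by (subst (asm) card_gt_0_iff) auto

lemma count_upto_0 [simp]: "count_upto D T 0 k = 0"
  by (simp add: count_upto_def)

lemma content_count_upto:
  assumes "is_partition \<beta>" "part_length \<beta> \<le> n"
  shows "content \<alpha> \<beta> T k = \<alpha> k + count_upto (young_diagram \<beta>) T n k"
proof -
  have "{x \<in> young_diagram \<beta>. T x = k} = {x \<in> young_diagram \<beta>. fst x < n \<and> T x = k}"
    using young_diagram_row[OF _ assms(1)] assms(2) by fastforce
  then show ?thesis by (simp add: content_def count_upto_def)
qed

text \<open>Since \<alpha> contributes no letter \<open>k\<close>, the lattice condition demands a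
  \<open>k\<close> in a strictly higher row. All upper bounds on entries come from descending along
  such predecessors.\<close>

lemma LR_tab_pred:
  assumes "LR_tab \<alpha> \<beta> T" "is_partition \<alpha>" "is_partition \<beta>"
    and "(i, j) \<in> young_diagram \<beta>" "T (i, j) = Suc k" "part_length \<alpha> \<le> k"
  shows "\<exists>i' j'. i' < i \<and> (i', j') \<in> young_diagram \<beta> \<and> T (i', j') = k"
proof -
  have "0 < count_upto (young_diagram \<beta>) T (Suc i) (Suc k)"
    by (rule count_upto_pos[where x = "(i, j)"]) (use assms finite_young_diagram in auto)
  also have "\<dots> \<le> \<alpha> k + count_upto (young_diagram \<beta>) T i k"
    using assms(1) unfolding LR_tab_def by (meson le_add2 order_trans)
  also have "\<alpha> k = 0" using part_length_iff[OF assms(2), of k] assms(6) by simp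
  finally have "0 < count_upto (young_diagram \<beta>) T i k" by simp
  from count_upto_posD[OF this] show ?thesis by blast
qed

text \<open>Each predecessor step lowers the letter by one and the row by at least one, so the bound
  \<open>b\<close> of the first row grows by at most one per row. Later \<open>b\<close> is
  \<open>part_length \<alpha>\<close> or one more, depending on whether the first row is constantly
  0.\<close>

lemma LR_tab_bound:
  assumes "LR_tab \<alpha> \<beta> T" "is_partition \<alpha>" "is_partition \<beta>"
    and "part_length \<alpha> \<le> b" "\<And>j. j < \<beta> 0 \<Longrightarrow> T (0, j) < b"
    and "(i, j) \<in> young_diagram \<beta>"
  shows "T (i, j) < b + i"
  using assms(6)
proof (induction i arbitrary: j rule: less_induct)
  case (less i)
  show ?case
  proof (rule ccontr)
    assume "\<not> T (i, j) < b + i"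
    then have ge: "b + i \<le> T (i, j)" by simp
    have "0 < i" using assms(5)[of j] less.prems ge by (cases i) auto
    define k where "k = T (i, j) - 1"
    have k: "T (i, j) = Suc k" "b + i \<le> Suc k" using ge \<open>0 < i\<close> by (auto simp: k_def)
    then obtain i' j' where "i' < i" "(i', j') \<in> young_diagram \<beta>" "T (i', j') = k"
      using LR_tab_pred[OF assms(1-3) less.prems k(1)] assms(4) \<open>0 < i\<close> by fastforce
    with less.IH[of i' j'] k show False by simp
  qed
qed

lemma LR_tab_row_0:
  assumes "LR_tab \<alpha> \<beta> T" "is_partition \<alpha>" "is_partition \<beta>" "j < \<beta> 0"
  shows "T (0, j) < Suc (part_length \<alpha>)"
proof (rule ccontr)
  assume "\<not> T (0, j) < Suc (part_length \<alpha>)"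
  then obtain k where "T (0, j) = Suc k" "part_length \<alpha> \<le> k"
    by (metis Suc_le_D Suc_le_mono not_less)
  then show False using LR_tab_pred[OF assms(1-3), of 0 j k] assms(4) by auto
qed

lemma LR_tab_le:
  assumes "LR_tab \<alpha> \<beta> T" "is_partition \<alpha>" "is_partition \<beta>" "(i, j) \<in> young_diagram \<beta>"
  shows "T (i, j) \<le> part_length \<alpha> + i"
  using LR_tab_bound[OF assms(1-3) _ LR_tab_row_0[OF assms(1-3)] assms(4)] by simp

text \<open>The last row of \<beta> has index \<open>part_length \<beta> - 1\<close>, so all entries
  lie below \<open>b + part_length \<beta> - 1\<close>; hence the \<open>Suc k\<close> in the last
  hypothesis.\<close>

lemma content_eq_0:
  assumes "LR_tab \<alpha> \<beta> T" "is_partition \<alpha>" "is_partition \<beta>"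
    and "part_length \<alpha> \<le> b" "\<And>j. j < \<beta> 0 \<Longrightarrow> T (0, j) < b"
    and "part_length \<alpha> \<le> k" "b + part_length \<beta> \<le> Suc k"
  shows "content \<alpha> \<beta> T k = 0"
proof -
  have "\<alpha> k = 0" using part_length_iff[OF assms(2)] assms(6) by (meson not_less)
  moreover have "T x \<noteq> k" if x: "x \<in> young_diagram \<beta>" for x
  proof (cases x)
    case (Pair i j)
    then have "T x < b + i" using LR_tab_bound[OF assms(1-3) assms(4) assms(5)] x by blast
    moreover have "i < part_length \<beta>" using young_diagram_row assms(3) x Pair by blast
    ultimately show ?thesis using assms(7) by simp
  qed
  then have "{x \<in> young_diagram \<beta>. T x = k} = {}" by blast
  ultimately show ?thesis by (simp only: content_def card.empty)
qed

lemma content_partition: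
  assumes "LR_tab \<alpha> \<beta> T" "is_partition \<alpha>" "is_partition \<beta>"
  shows "is_partition (content \<alpha> \<beta> T)"
proof -
  let ?n = "part_length \<beta>" and ?D = "young_diagram \<beta>"
  have "content \<alpha> \<beta> T (Suc k) \<le> content \<alpha> \<beta> T k" for k
  proof -
    \<comment> \<open>Both \<open>?n\<close> and \<open>Suc ?n\<close> exceed all row indices, so
      both counts run over the whole diagram.\<close>
    have "\<alpha> (Suc k) + count_upto ?D T (Suc ?n) (Suc k) \<le> \<alpha> k + count_upto ?D T ?n k"
      using assms(1) unfolding LR_tab_def by blast
    then show ?thesis
      using content_count_upto[OF assms(3), of "Suc ?n"] content_count_upto[OF assms(3), of ?n] by simp
  qed
  then have "antimono (content \<alpha> \<beta> T)" by (simp add: antimono_iff_le_Suc)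
  moreover have "{k. content \<alpha> \<beta> T k \<noteq> 0} \<subseteq> {..<Suc (part_length \<alpha> + ?n)}"
  proof
    fix k assume "k \<in> {k. content \<alpha> \<beta> T k \<noteq> 0}"
    then show "k \<in> {..<Suc (part_length \<alpha> + ?n)}"
      using content_eq_0[OF assms _ LR_tab_row_0[OF assms], of k] by force
  qed
  ultimately show ?thesis unfolding is_partition_def using finite_subset by blast
qed

lemma content_0:
  assumes "semistandard (young_diagram \<beta>) T" "is_partition \<beta>"
  shows "content \<alpha> \<beta> T 0 = \<alpha> 0 + card {j. j < \<beta> 0 \<and> T (0, j) = 0}"
proof -
  have "{x \<in> young_diagram \<beta>. T x = 0} = Pair 0 ` {j. j < \<beta> 0 \<and> T (0, j) = 0}"
    using semistandard_ge_row[OF assms] by fastforce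
  moreover have "card (Pair (0::nat) ` {j. j < \<beta> 0 \<and> T (0, j) = 0}) = card {j. j < \<beta> 0 \<and> T (0, j) = 0}"
    by (intro card_image) (simp add: inj_on_def)
  ultimately show ?thesis by (simp add: content_def)
qed

section \<open>Stripping one layer from \<beta>: the first row and the row ends\<close>

locale nonempty_partitions =
  fixes \<alpha> \<beta> :: "nat \<Rightarrow> nat"
  assumes part_a: "is_partition \<alpha>" and part_b: "is_partition \<beta>"
    and a_pos: "0 < \<alpha> 0" and b_pos: "0 < \<beta> 0"
begin

abbreviation "la \<equiv> part_length \<alpha>"
abbreviation "lb \<equiv> part_length \<beta>"

lemma la_pos: "0 < la" and lb_pos: "0 < lb"
  using part_length_pos part_a part_b a_pos b_pos by auto

text \<open>The bit \<open>c\<close> records whether the first row ends in \<open>la\<close>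
  (\<open>c = 1\<close>) or is constantly 0 (\<open>c = 0\<close>). The other row ends are then the
  largest letters that \<open>LR_tab_bound\<close> allows for \<open>b = la + c\<close>.\<close>

definition extremal :: "nat \<Rightarrow> (nat \<times> nat \<Rightarrow> nat) \<Rightarrow> bool" where
  "extremal c T \<longleftrightarrow> (\<forall>j<\<beta> 0. T (0, j) = (if j < \<beta> 0 - c then 0 else la)) \<and>
     (\<forall>i. 0 < i \<and> i < lb \<longrightarrow> T (i, \<beta> i - 1) = la + c + i - 1)"

text \<open>Row \<open>i + 1\<close> of \<beta> without its last box has the length of row
  \<open>i\<close> of \<open>peel \<beta>\<close>. So the row ends are removed in place of the first
  column, and the other boxes keep their column index.\<close>

definition extend_tab :: "nat \<Rightarrow> (nat \<times> nat \<Rightarrow> nat) \<Rightarrow> nat \<times> nat \<Rightarrow> nat" where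
  "extend_tab c T' = restrict (\<lambda>(i, j).
     if i = 0 then (if j < \<beta> 0 - c then 0 else la)
     else if Suc j = \<beta> i then la + c + i - 1 else Suc (T' (i - 1, j))) (young_diagram \<beta>)"

definition peel_tab :: "(nat \<times> nat \<Rightarrow> nat) \<Rightarrow> nat \<times> nat \<Rightarrow> nat" where
  "peel_tab T = restrict (\<lambda>(i, j). T (Suc i, j) - 1) (young_diagram (peel \<beta>))"

lemma extend_tab_row_0: "j < \<beta> 0 \<Longrightarrow> extend_tab c T' (0, j) = (if j < \<beta> 0 - c then 0 else la)"
  by (simp add: extend_tab_def)

lemma extend_tab_end: "0 < i \<Longrightarrow> Suc j = \<beta> i \<Longrightarrow> extend_tab c T' (i, j) = la + c + i - 1"
  by (auto simp: extend_tab_def)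

lemma extend_tab_inner: "Suc j < \<beta> (Suc i) \<Longrightarrow> extend_tab c T' (Suc i, j) = Suc (T' (i, j))"
  by (simp add: extend_tab_def)

lemma extremal_extend_tab: "extremal c (extend_tab c T')"
proof -
  have "Suc (\<beta> i - 1) = \<beta> i" if "i < lb" for i
    using part_length_iff[OF part_b, of i] that by simp
  then show ?thesis by (auto simp: extremal_def extend_tab_row_0 extend_tab_end)
qed

lemma peel_extend_tab:
  assumes "T' \<in> extensional (young_diagram (peel \<beta>))"
  shows "peel_tab (extend_tab c T') = T'"
proof (rule extensionalityI[OF _ assms])
  fix x assume "x \<in> young_diagram (peel \<beta>)"
  then show "peel_tab (extend_tab c T') x = T' x"
    by (cases x) (auto simp: peel_tab_def extend_tab_inner peel_def)
qed (simp add: peel_tab_def)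

lemma extend_peel_tab:
  assumes "LR_tab \<alpha> \<beta> T" "extremal c T"
  shows "extend_tab c (peel_tab T) = T"
proof (rule extensionalityI)
  show "T \<in> extensional (young_diagram \<beta>)" using assms(1) by (simp add: LR_tab_def)
  fix x assume x: "x \<in> young_diagram \<beta>"
  obtain i j where ij: "x = (i, j)" "j < \<beta> i" using x by (cases x) auto
  show "extend_tab c (peel_tab T) x = T x"
  proof (cases i)
    case 0
    then show ?thesis using ij assms(2) by (simp add: extend_tab_row_0 extremal_def)
  next
    case (Suc i')
    have lb: "i < lb" using young_diagram_row[OF _ part_b] x ij by blast
    show ?thesis
    proof (cases "Suc j = \<beta> i")
      case True
      then have "j = \<beta> i - 1" by simp
      then show ?thesis using True ij lb Suc assms(2) by (auto simp: extend_tab_end extremal_def)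
    next
      case False
      then have "Suc j < \<beta> (Suc i')" using ij Suc by simp
      moreover have "0 < T (i, j)"
        using semistandard_ge_row[OF _ part_b, of T i j] assms(1) x ij Suc by (auto simp: LR_tab_def)
      ultimately show ?thesis using ij Suc
        by (auto simp: extend_tab_inner peel_tab_def peel_def)
    qed
  qed
qed (simp add: extend_tab_def)

text \<open>The row ends carry consecutive letters from \<open>la\<close> on, one per row, so each
  \<open>Suc k\<close> occurs at most once among them. For \<open>c = 1\<close> this sequence starts
  in row 0, for \<open>c = 0\<close> in row 1.\<close>

lemma count_extend_tab:
  assumes "c \<le> 1"
  shows "count_upto (young_diagram \<beta>) (extend_tab c T') (Suc n) (Suc k) =
    count_upto (young_diagram (peel \<beta>)) T' n k
      + (if la \<le> Suc k \<and> Suc k < la + c + min n (lb - 1) then 1 else 0)"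
proof -
  let ?f = "\<lambda>(i, j). (Suc i, j) :: nat \<times> nat"
  let ?T = "extend_tab c T'"
  let ?L = "{x \<in> young_diagram \<beta>. fst x < Suc n \<and> ?T x = Suc k}"
  let ?S = "{x \<in> young_diagram (peel \<beta>). fst x < n \<and> T' x = k}"
  let ?C = "la \<le> Suc k \<and> Suc k < la + c + min n (lb - 1)"
  \<comment> \<open>The row whose end carries \<open>Suc k\<close>, from solving
    \<open>la + c + ?r - 1 = Suc k\<close>.\<close>
  let ?r = "Suc (Suc k) - la - c"
  let ?E = "if ?C then {(?r, \<beta> ?r - 1)} else {}"
  have "?L = ?f ` ?S \<union> ?E"
  proof (intro equalityI subsetI)
    fix x assume x: "x \<in> ?L"
    obtain i j where ij: "x = (i, j)" by (cases x)
    have j: "j < \<beta> i" "i \<le> n" "?T (i, j) = Suc k" using x ij by auto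
    have lb: "i < lb" using j part_length_iff[OF part_b, of i] by simp
    consider "i = 0" | "0 < i" "Suc j = \<beta> i" | i' where "i = Suc i'" "Suc j < \<beta> i"
      using j by (metis Suc_lessI gr0_implies_Suc neq0_conv)
    then show "x \<in> ?f ` ?S \<union> ?E"
    proof cases
      case 1
      then have "\<not> j < \<beta> 0 - c" "Suc k = la" using j by (auto simp: extend_tab_row_0 split: if_splits)
      then have "c = 1" "j = \<beta> 0 - 1" using 1 j assms by (cases c; auto)+
      then have "x \<in> ?E" using 1 ij \<open>Suc k = la\<close> by auto
      then show ?thesis by blast
    next
      case 2
      then have "Suc k = la + c + i - 1" using j extend_tab_end by simp
      moreover have "j = \<beta> i - 1" using 2 by simp
      ultimately have "x \<in> ?E" using ij j lb 2 by auto
      then show ?thesis by blast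
    next
      case 3
      then have "(i', j) \<in> ?S" using j by (auto simp: extend_tab_inner peel_def)
      then show ?thesis using ij 3 by force
    qed
  next
    fix x assume "x \<in> ?f ` ?S \<union> ?E"
    then show "x \<in> ?L"
    proof
      assume "x \<in> ?f ` ?S"
      then obtain i j where "x = (Suc i, j)" "(i, j) \<in> ?S" by auto
      then show ?thesis by (auto simp: extend_tab_inner peel_def)
    next
      assume "x \<in> ?E"
      then have C: ?C and x: "x = (?r, \<beta> ?r - 1)" by (auto split: if_splits)
      have r: "?r \<le> n" "?r < lb" using C lb_pos assms by auto
      then have "\<beta> ?r \<noteq> 0" using part_length_iff[OF part_b] by simp
      then have mem: "x \<in> young_diagram \<beta>" "Suc (\<beta> ?r - 1) = \<beta> ?r" using x by auto
      have "?T x = Suc k"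
      proof (cases "?r = 0")
        case True
        then have "c = 1" "Suc k = la" using C assms by auto
        then show ?thesis using x True extend_tab_row_0[of "\<beta> 0 - 1"] b_pos by simp
      next
        case False
        then show ?thesis using x mem C extend_tab_end[of ?r "\<beta> ?r - 1"] by simp
      qed
      then show ?thesis using mem r x by simp
    qed
  qed
  moreover have "?f ` ?S \<inter> ?E = {}"
  proof -
    \<comment> \<open>A box coming from \<open>peel \<beta>\<close> is never the last one of its
      row.\<close>
    have "(?r, \<beta> ?r - 1) \<noteq> ?f y" if "y \<in> ?S" for y
    proof
      assume eq: "(?r, \<beta> ?r - 1) = ?f y"
      obtain i j where "y = (i, j)" by (cases y)
      with eq have "?r = Suc i" "\<beta> (Suc i) - 1 = j" by auto
      with that \<open>y = (i, j)\<close> show False by (simp add: peel_def)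
    qed
    then show ?thesis by auto
  qed
  moreover have fin: "finite ?S" using finite_young_diagram[OF peel_partition[OF part_b]] by simp
  ultimately have "card ?L = card (?f ` ?S) + card ?E" by (simp add: card_Un_disjoint)
  also have "card (?f ` ?S) = card ?S" by (intro card_image) (auto simp: inj_on_def)
  finally show ?thesis by (auto simp: count_upto_def)
qed

lemma peel_add: "peel \<alpha> k + (if Suc k < la then 1 else 0) = \<alpha> (Suc k)"
  using part_length_iff[OF part_a, of "Suc k"] by (auto simp: peel_def)

text \<open>The first column of \<alpha> supplies the positive letters below \<open>la\<close> and
  the row ends those from \<open>la\<close> on. Together they form one interval, so the lower limit
  in \<open>count_extend_tab\<close> disappears.\<close>

lemma weighted_count_extend_tab:
  assumes "c \<le> 1"
  shows "\<alpha> (Suc k) + count_upto (young_diagram \<beta>) (extend_tab c T') (Suc n) (Suc k) =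
    peel \<alpha> k + count_upto (young_diagram (peel \<beta>)) T' n k
      + (if Suc k < la + c + min n (lb - 1) then 1 else 0)"
  unfolding count_extend_tab[OF assms] peel_add[of k, symmetric] by auto

lemma count_extend_tab_0:
  assumes "c \<le> 1"
  shows "count_upto (young_diagram \<beta>) (extend_tab c T') (Suc n) 0 = \<beta> 0 - c"
proof -
  have "{x \<in> young_diagram \<beta>. fst x < Suc n \<and> extend_tab c T' x = 0} = Pair 0 ` {..<\<beta> 0 - c}"
    using la_pos by (auto simp: extend_tab_def split: if_splits)
  then show ?thesis by (simp add: count_upto_def card_image inj_on_def)
qed

lemma part_length_peel_a: "part_length (peel \<alpha>) < la"
  by (rule part_length_peel_less[OF part_a a_pos])

text \<open>Peeling shortens \<alpha>, so the inner entries of row \<open>i + 1\<close> are at most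
  \<open>la + i\<close>, which the row end \<open>la + c + i\<close> dominates. In a column every
  box below a row end is again a row end, and these letters increase from row to row.\<close>

lemma extend_tab_semistandard:
  assumes "LR_tab (peel \<alpha>) (peel \<beta>) T'" "c \<le> 1"
  shows "semistandard (young_diagram \<beta>) (extend_tab c T')"
proof -
  let ?T = "extend_tab c T'"
  have ss: "semistandard (young_diagram (peel \<beta>)) T'" using assms(1) by (simp add: LR_tab_def)
  have bound: "Suc (T' (i, j)) \<le> la + i" if "Suc j < \<beta> (Suc i)" for i j
  proof -
    have "j < peel \<beta> i" using that by (simp add: peel_def)
    then have "T' (i, j) \<le> part_length (peel \<alpha>) + i"
      using LR_tab_le[OF assms(1) peel_partition[OF part_a] peel_partition[OF part_b]] by simp
    then show ?thesis using part_length_peel_a by simp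
  qed
  have "?T (i, j) \<le> ?T (i, j')" if ij: "j < \<beta> i" "j' < \<beta> i" "j < j'" for i j j'
  proof (cases i)
    case 0
    then show ?thesis using ij by (simp add: extend_tab_row_0)
  next
    case (Suc i')
    have j: "Suc j < \<beta> (Suc i')" using ij Suc by simp
    show ?thesis
    proof (cases "Suc j' = \<beta> i")
      case True
      then show ?thesis using extend_tab_inner[OF j] extend_tab_end[of i j'] Suc bound[OF j] by simp
    next
      case False
      then have j': "Suc j' < \<beta> (Suc i')" using ij Suc by simp
      show ?thesis
        using extend_tab_inner[OF j] extend_tab_inner[OF j'] Suc ij j j'
          semistandard_rowD[OF ss, of i' j j'] by (simp add: peel_def)
    qed
  qed
  moreover have "?T (i, j) < ?T (i', j)" if ij: "j < \<beta> i" "j < \<beta> i'" "i < i'" for i i' j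
  proof -
    have mono: "\<beta> i' \<le> \<beta> i" using partition_antimonoD[OF part_b] ij by simp
    obtain m' where m': "i' = Suc m'" using ij by (cases i') auto
    have pos: "0 < ?T (i', j)"
    proof (cases "Suc j = \<beta> i'")
      case True then show ?thesis using extend_tab_end[of i' j] m' la_pos by simp
    next
      case False
      then show ?thesis using extend_tab_inner[of j m'] m' ij by simp
    qed
    show ?thesis
    proof (cases i)
      case 0
      show ?thesis
      proof (cases "j < \<beta> 0 - c")
        case True
        then show ?thesis using 0 pos ij by (simp add: extend_tab_row_0)
      next
        case False
        then have "c = 1" "Suc j = \<beta> i'" using assms(2) ij mono 0 by (cases c; auto)+
        then show ?thesis using False 0 ij extend_tab_end[of i' j] by (simp add: extend_tab_row_0)
      qed
    next
      case (Suc m)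
      show ?thesis
      proof (cases "Suc j = \<beta> i'")
        case end': True
        show ?thesis
        proof (cases "Suc j = \<beta> i")
          case True
          then show ?thesis using end' extend_tab_end[of i j] extend_tab_end[of i' j] ij Suc la_pos by simp
        next
          case False
          then have "Suc j < \<beta> (Suc m)" using ij Suc by simp
          then show ?thesis
            using end' extend_tab_inner[of j m] extend_tab_end[of i' j] bound[of j m] ij Suc by simp
        qed
      next
        case False
        then have "Suc j < \<beta> (Suc m')" "Suc j < \<beta> (Suc m)" using ij mono m' Suc by auto
        then show ?thesis
          using extend_tab_inner[of j m] extend_tab_inner[of j m'] Suc m' ij
            semistandard_colD[OF ss, of m j m'] by (simp add: peel_def)
      qed
    qed
  qed
  ultimately show ?thesis unfolding semistandard_def by simp
qed

lemma peel_tab_semistandard: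
  assumes "semistandard (young_diagram \<beta>) T"
  shows "semistandard (young_diagram (peel \<beta>)) (peel_tab T)"
proof -
  have mem: "j < \<beta> (Suc i)" if "j < peel \<beta> i" for i j using that by (simp add: peel_def)
  have pos: "0 < T (Suc i, j)" if "j < peel \<beta> i" for i j
    using semistandard_ge_row[OF assms part_b, of "Suc i" j] mem[OF that] by simp
  have "T (Suc i, j) - 1 \<le> T (Suc i, j') - 1" if "j < peel \<beta> i" "j' < peel \<beta> i" "j < j'" for i j j'
    using semistandard_rowD[OF assms, of "Suc i" j j'] mem that by (simp add: diff_le_mono)
  moreover have "T (Suc i, j) - 1 < T (Suc i', j) - 1"
    if "j < peel \<beta> i" "j < peel \<beta> i'" "i < i'" for i i' j
    using semistandard_colD[OF assms, of "Suc i" j "Suc i'"] mem pos[of j i] that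
    by (simp add: diff_less_mono)
  ultimately show ?thesis unfolding semistandard_def by (simp add: peel_tab_def)
qed

lemma peel_0_less: "peel \<alpha> 0 < \<alpha> 0" "peel \<beta> 0 < \<beta> 0"
proof -
  have "\<alpha> (Suc 0) \<le> \<alpha> 0" "\<beta> (Suc 0) \<le> \<beta> 0"
    using partition_antimonoD part_a part_b by auto
  then show "peel \<alpha> 0 < \<alpha> 0" "peel \<beta> 0 < \<beta> 0" using a_pos b_pos unfolding peel_def by linarith+
qed

text \<open>By \<open>weighted_count_extend_tab\<close> both sides of the lattice condition are
  those for \<open>T'\<close> plus an indicator. The letter 0 and the empty prefix are not of that
  form, whence the cases \<open>k = 0\<close> and \<open>n = 0\<close>.\<close>

lemma LR_tab_extend:
  assumes "LR_tab (peel \<alpha>) (peel \<beta>) T'" "c \<le> 1"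
  shows "LR_tab \<alpha> \<beta> (extend_tab c T')"
proof -
  let ?T = "extend_tab c T'" and ?D = "young_diagram \<beta>" and ?D' = "young_diagram (peel \<beta>)"
  note parts = peel_partition[OF part_a] peel_partition[OF part_b]
  note F = weighted_count_extend_tab[OF assms(2), of _ T']
  have lat: "peel \<alpha> (Suc k) + count_upto ?D' T' (Suc n) (Suc k) \<le> peel \<alpha> k + count_upto ?D' T' n k" for n k
    using assms(1) by (simp add: LR_tab_def)
  have zero: "count_upto ?D' T' n 0 \<le> peel \<beta> 0" for n
  proof -
    have "{x \<in> ?D'. fst x < n \<and> T' x = 0} \<subseteq> Pair 0 ` {..<peel \<beta> 0}"
      using semistandard_ge_row[OF _ parts(2), of T'] assms(1) unfolding LR_tab_def by fastforce
    then have "card {x \<in> ?D'. fst x < n \<and> T' x = 0} \<le> card (Pair (0::nat) ` {..<peel \<beta> 0})"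
      by (intro card_mono) auto
    then show ?thesis by (simp add: count_upto_def card_image inj_on_def)
  qed
  have "\<alpha> (Suc k) + count_upto ?D ?T (Suc n) (Suc k) \<le> \<alpha> k + count_upto ?D ?T n k" for n k
  proof (cases k)
    case k0: 0
    show ?thesis
    proof (cases n)
      case 0
      have "peel \<alpha> 0 + (if Suc 0 < la + c then 1 else 0) \<le> \<alpha> 0" using peel_0_less by simp
      then show ?thesis using F[of 0 0] k0 0 by simp
    next
      case (Suc m)
      \<comment> \<open>Each strict inequality of \<open>peel_0_less\<close> leaves one unit to
        spare: one pays for the new row end, the other for \<open>c\<close>.\<close>
      have "peel \<alpha> 0 + count_upto ?D' T' n 0 + 1 \<le> \<alpha> 0 + (\<beta> 0 - c)"
        using zero[of n] peel_0_less assms(2) by linarith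
      then show ?thesis using F[of 0 n] k0 Suc count_extend_tab_0[OF assms(2), of T' m] by simp
    qed
  next
    case k: (Suc k')
    show ?thesis
    proof (cases n)
      case 0
      have "peel \<alpha> (Suc k') \<le> peel \<alpha> k'" using partition_antimonoD[OF parts(1)] by simp
      moreover have "(if Suc (Suc k') < la + c then 1::nat else 0) \<le> (if Suc k' < la then 1 else 0)"
        using assms(2) by simp
      ultimately show ?thesis using F[of k 0] k 0 peel_add[of k'] by simp
    next
      case (Suc m)
      \<comment> \<open>The upper limit for the letters grows by at most one per row, so the
        indicator on the left never exceeds the one on the right.\<close>
      have "(if Suc k < la + c + min n (lb - 1) then 1::nat else 0)
          \<le> (if Suc k' < la + c + min m (lb - 1) then 1 else 0)"
        using k Suc by auto
      then show ?thesis using F[of k n] F[of k' m] lat[of k' m] unfolding k Suc by linarith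
    qed
  qed
  then show ?thesis
    using extend_tab_semistandard[OF assms] by (simp add: LR_tab_def extend_tab_def)
qed

lemma LR_tab_extremal_bound:
  assumes "LR_tab \<alpha> \<beta> T" "extremal c T" "c \<le> 1" "(i, j) \<in> young_diagram \<beta>"
  shows "T (i, j) < la + c + i"
proof (rule LR_tab_bound[OF assms(1) part_a part_b _ _ assms(4)])
  fix j assume "j < \<beta> 0"
  then show "T (0, j) < la + c"
    using assms(2,3) la_pos by (cases c) (auto simp: extremal_def)
qed simp

text \<open>If the indicator for \<open>Suc (Suc k)\<close> is one, so is that for
  \<open>Suc k\<close>, and the two cancel. Otherwise the letter exceeds the bound on all rows read,
  and the left side vanishes.\<close>

lemma LR_tab_peel:
  assumes "LR_tab \<alpha> \<beta> T" "extremal c T" "c \<le> 1"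
  shows "LR_tab (peel \<alpha>) (peel \<beta>) (peel_tab T)"
proof -
  let ?T' = "peel_tab T" and ?D = "young_diagram \<beta>" and ?D' = "young_diagram (peel \<beta>)"
  have "peel \<alpha> (Suc k) + count_upto ?D' ?T' (Suc n) (Suc k) \<le> peel \<alpha> k + count_upto ?D' ?T' n k" for n k
  proof (cases "Suc (Suc k) < la + c + min (Suc n) (lb - 1)")
    case True
    then have "Suc k < la + c + min n (lb - 1)" by auto
    moreover have "\<alpha> (Suc (Suc k)) + count_upto ?D T (Suc (Suc n)) (Suc (Suc k))
        \<le> \<alpha> (Suc k) + count_upto ?D T (Suc n) (Suc k)"
      using assms(1) unfolding LR_tab_def by blast
    ultimately show ?thesis
      using True weighted_count_extend_tab[OF assms(3), of "Suc k" ?T' "Suc n"]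
        weighted_count_extend_tab[OF assms(3), of k ?T' n] extend_peel_tab[OF assms(1,2)] by simp
  next
    case False
    have "\<alpha> (Suc (Suc k)) = 0" using part_length_iff[OF part_a, of "Suc (Suc k)"] False by simp
    then have "peel \<alpha> (Suc k) = 0" by (simp add: peel_def)
    moreover have "count_upto ?D' ?T' (Suc n) (Suc k) = 0"
    proof (rule ccontr)
      assume "count_upto ?D' ?T' (Suc n) (Suc k) \<noteq> 0"
      then obtain i j where ij: "(i, j) \<in> ?D'" "i < Suc n" "?T' (i, j) = Suc k"
        using count_upto_posD by blast
      then have "T (Suc i, j) = Suc (Suc k)" and D: "(Suc i, j) \<in> ?D"
        by (auto simp: peel_tab_def peel_def)
      moreover have "T (Suc i, j) < la + c + Suc i"
        by (rule LR_tab_extremal_bound[OF assms D])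
      moreover have "Suc i < lb" using young_diagram_row[OF D part_b] .
      ultimately show False using False ij by simp
    qed
    ultimately show ?thesis by simp
  qed
  then show ?thesis
    using peel_tab_semistandard assms(1) by (simp add: LR_tab_def peel_tab_def)
qed

lemma content_extremal:
  assumes "LR_tab \<alpha> \<beta> T" "extremal c T" "c \<le> 1"
  shows "content \<alpha> \<beta> T (Suc k) = content (peel \<alpha>) (peel \<beta>) (peel_tab T) k
           + (if Suc k < la + c + (lb - 1) then 1 else 0)"
    and "content \<alpha> \<beta> T 0 = \<alpha> 0 + \<beta> 0 - c"
proof -
  have T: "extend_tab c (peel_tab T) = T" by (rule extend_peel_tab[OF assms(1,2)])
  have le: "part_length (peel \<beta>) \<le> lb - 1" using part_length_peel_less[OF part_b b_pos] by simp
  have lb: "Suc (lb - 1) = lb" using lb_pos by simp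
  show "content \<alpha> \<beta> T (Suc k) = content (peel \<alpha>) (peel \<beta>) (peel_tab T) k
           + (if Suc k < la + c + (lb - 1) then 1 else 0)"
    using weighted_count_extend_tab[OF assms(3), of k "peel_tab T" "lb - 1"] T lb
      content_count_upto[OF part_b, of lb \<alpha> T]
      content_count_upto[OF peel_partition[OF part_b] le, of "peel \<alpha>" "peel_tab T" k] by simp
  show "content \<alpha> \<beta> T 0 = \<alpha> 0 + \<beta> 0 - c"
    using count_extend_tab_0[OF assms(3), of "peel_tab T" "lb - 1"] T lb b_pos assms(3)
      content_count_upto[OF part_b, of lb \<alpha> T 0] by simp
qed

lemma part_length_content_extremal:
  assumes "LR_tab \<alpha> \<beta> T" "extremal c T" "c \<le> 1"
  shows "part_length (content \<alpha> \<beta> T) = la + c + (lb - 1)"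
proof (rule part_length_eqI)
  fix k
  show "content \<alpha> \<beta> T k \<noteq> 0 \<longleftrightarrow> k < la + c + (lb - 1)"
  proof (cases k)
    case 0
    then show ?thesis using content_extremal(2)[OF assms] a_pos b_pos assms(3) la_pos by simp
  next
    case (Suc k')
    have row0: "T (0, j) < la + c" if "j < \<beta> 0" for j
      using LR_tab_extremal_bound[OF assms, of 0 j] that by simp
    have "content \<alpha> \<beta> T k = 0" if "\<not> k < la + c + (lb - 1)"
      using content_eq_0[OF assms(1) part_a part_b _ row0, of k] that lb_pos by simp
    moreover have "content \<alpha> \<beta> T k \<noteq> 0" if "k < la + c + (lb - 1)"
      using content_extremal(1)[OF assms, of k'] that Suc by simp
    ultimately show ?thesis by (cases "k < la + c + (lb - 1)") auto
  qed
qed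

text \<open>This makes the recursion on fillings compatible with \<open>hl_Suc\<close>. The
  truncated subtraction is harmless because the indicator in \<open>content_extremal\<close> marks
  exactly the nonzero parts.\<close>

lemma peel_content_extremal:
  assumes "LR_tab \<alpha> \<beta> T" "extremal c T" "c \<le> 1"
  shows "peel (content \<alpha> \<beta> T) = content (peel \<alpha>) (peel \<beta>) (peel_tab T)"
proof
  fix k
  show "peel (content \<alpha> \<beta> T) k = content (peel \<alpha>) (peel \<beta>) (peel_tab T) k"
  proof (cases "Suc k < la + c + (lb - 1)")
    case True
    then show ?thesis using content_extremal(1)[OF assms, of k] by (simp add: peel_def)
  next
    case False
    then have "content \<alpha> \<beta> T (Suc k) = 0"
      using part_length_content_extremal[OF assms]
        part_length_iff[OF content_partition[OF assms(1) part_a part_b], of "Suc k"] by simp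
    then show ?thesis using content_extremal(1)[OF assms, of k] by (simp add: peel_def)
  qed
qed

lemma content_0_pos: "0 < content \<alpha> \<beta> T 0"
  using a_pos by (simp add: content_def)

text \<open>Taking \<open>c = 1\<close> instead of \<open>c = 0\<close> shortens the first row of
  \<nu> by one box and lengthens its first column by one, so the corner hook does not see
  \<open>c\<close>.\<close>

lemma hl_0_extremal:
  assumes "LR_tab \<alpha> \<beta> T" "extremal c T" "c \<le> 1"
  shows "hl (content \<alpha> \<beta> T) 0 = hl \<alpha> 0 + hl \<beta> 0"
  using hl_0[OF content_partition[OF assms(1) part_a part_b] content_0_pos]
    hl_0[OF part_a a_pos] hl_0[OF part_b b_pos] part_length_content_extremal[OF assms]
    content_extremal(2)[OF assms] la_pos lb_pos a_pos b_pos assms(3) by linarith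

text \<open>If the content is as long as the bound on the entries permits, then the lattice condition
  forces every row to end in the largest admissible entry: an entry can only reach this bound
  if its predecessor does so in the row above.\<close>

lemma row_ends_maximal:
  assumes LR: "LR_tab \<alpha> \<beta> T" and c: "c \<le> 1" and row0: "\<And>j. j < \<beta> 0 \<Longrightarrow> T (0, j) < la + c"
    and len: "content \<alpha> \<beta> T (la + c + lb - 2) \<noteq> 0"
    and i: "1 - c \<le> i" "i < lb"
  shows "T (i, \<beta> i - 1) = la + c + i - 1"
proof -
  have ss: "semistandard (young_diagram \<beta>) T" using LR by (simp add: LR_tab_def)
  note bound = LR_tab_bound[OF LR part_a part_b _ row0, simplified]
  \<comment> \<open>Downward induction from the last row. Finding the letter anywhere in the row is
    enough: monotonicity and the bound then move it to the row end.\<close>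
  have ex: "\<exists>j. (i, j) \<in> young_diagram \<beta> \<and> T (i, j) = la + c + i - 1"
    using i(2,1)
  proof (induction i rule: strict_inc_induct)
    case (base i)
    \<comment> \<open>No row above the last admits so large a letter, and \<alpha> does not
      contribute it, so \<open>len\<close> puts it in row \<open>lb - 1\<close>.\<close>
    let ?k = "la + c + lb - 2"
    have "la \<le> ?k" using base c by auto
    then have "\<alpha> ?k = 0" using part_length_iff[OF part_a, of ?k] by simp
    with len have "{x \<in> young_diagram \<beta>. T x = ?k} \<noteq> {}" unfolding content_def by force
    then obtain i' j' where ij: "(i', j') \<in> young_diagram \<beta>" "T (i', j') = ?k" by auto
    have "i' < lb" using young_diagram_row[OF ij(1) part_b] .
    moreover have "?k < la + c + i'" using bound[of j' i'] ij by simp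
    ultimately have "i' = i" using base la_pos by simp
    then show ?case using ij base by auto
  next
    case (step i)
    obtain j where j: "(Suc i, j) \<in> young_diagram \<beta>" "T (Suc i, j) = la + c + Suc i - 1"
      using step by auto
    define k where "k = la + c + i - 1"
    \<comment> \<open>The restriction \<open>1 - c \<le> i\<close> enters here: in row 0 with
      \<open>c = 0\<close> the letter would be \<open>la - 1\<close>, which \<alpha> itself
      supplies.\<close>
    have "la \<le> k" using step.prems by (auto simp: k_def)
    moreover have "T (Suc i, j) = Suc k" using j la_pos by (simp add: k_def)
    ultimately obtain i' j' where ij: "i' < Suc i" "(i', j') \<in> young_diagram \<beta>" "T (i', j') = k"
      using LR_tab_pred[OF LR part_a part_b j(1)] by blast
    have "k < la + c + i'" using bound[of j' i'] ij by simp
    then have "i' = i" using ij la_pos by (auto simp: k_def)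
    then show ?case using ij by (auto simp: k_def)
  qed
  then obtain j where j: "(i, j) \<in> young_diagram \<beta>" "T (i, j) = la + c + i - 1" by blast
  have "T (i, j) \<le> T (i, \<beta> i - 1)" using semistandard_rowD[OF ss j(1)] j(1) by auto
  moreover have "T (i, \<beta> i - 1) < la + c + i" using bound[of "\<beta> i - 1" i] j(1) by auto
  ultimately show ?thesis using j la_pos by simp
qed

text \<open>Each nonzero entry of the first row costs a box in the first part of \<nu>, while all of
  them together gain at most one in its length. So equality allows at most one such entry and
  requires the full length, to which \<open>row_ends_maximal\<close> applies.\<close>

lemma hl_0_le_or_extremal:
  assumes LR: "LR_tab \<alpha> \<beta> T"
  shows "hl (content \<alpha> \<beta> T) 0 < hl \<alpha> 0 + hl \<beta> 0 \<or> (\<exists>c\<le>1. extremal c T)"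
proof -
  let ?nu = "content \<alpha> \<beta> T" and ?Z = "{j. j < \<beta> 0 \<and> T (0, j) = 0}"
  have ss: "semistandard (young_diagram \<beta>) T" using LR by (simp add: LR_tab_def)
  have part: "is_partition ?nu" by (rule content_partition[OF LR part_a part_b])
  have nu0: "?nu 0 = \<alpha> 0 + card ?Z" by (rule content_0[OF ss part_b])
  have hl: "hl ?nu 0 + 1 = ?nu 0 + part_length ?nu" "hl \<alpha> 0 + 1 = \<alpha> 0 + la" "hl \<beta> 0 + 1 = \<beta> 0 + lb"
    using hl_0[OF part content_0_pos] hl_0[OF part_a a_pos] hl_0[OF part_b b_pos] .
  show ?thesis
  proof (cases "\<forall>j<\<beta> 0. T (0, j) = 0")
    case True
    then have "?Z = {..<\<beta> 0}" by auto
    then have Z: "card ?Z = \<beta> 0" by simp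
    have row0: "T (0, j) < la + 0" if "j < \<beta> 0" for j using True that la_pos by simp
    have "?nu (la + lb - 1) = 0"
      using content_eq_0[OF LR part_a part_b _ row0, of "la + lb - 1"] lb_pos by simp
    then have le: "part_length ?nu \<le> la + lb - 1"
      using part_length_iff[OF part, of "la + lb - 1"] by simp
    show ?thesis
    proof (cases "part_length ?nu = la + lb - 1")
      case eq: True
      then have "?nu (la + 0 + lb - 2) \<noteq> 0"
        using part_length_iff[OF part, of "la + lb - 2"] la_pos lb_pos by simp
      then have "T (i, \<beta> i - 1) = la + 0 + i - 1" if "0 < i" "i < lb" for i
        using row_ends_maximal[OF LR _ row0, of i] that by simp
      then have "extremal 0 T" using True by (simp add: extremal_def)
      then show ?thesis by blast
    next
      case False
      then show ?thesis using le nu0 Z hl la_pos lb_pos by linarith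
    qed
  next
    case False
    then obtain j0 where j0: "j0 < \<beta> 0" "T (0, j0) \<noteq> 0" by blast
    \<comment> \<open>The zeros of the first row stop before \<open>j0\<close>, so
      \<open>card ?Z = \<beta> 0 - 1\<close> will make \<open>j0\<close> the last box.\<close>
    have Zsub: "?Z \<subseteq> {..<j0}"
      using semistandard_rowD[OF ss, of 0 j0] j0 by (force simp: not_less[symmetric])
    then have Zle: "card ?Z \<le> j0" using card_mono[of "{..<j0}" ?Z] by simp
    have row0: "T (0, j) < la + 1" if "j < \<beta> 0" for j
      using LR_tab_row_0[OF LR part_a part_b that] by simp
    have "?nu (la + lb) = 0"
      using content_eq_0[OF LR part_a part_b _ row0, of "la + lb"] by simp
    then have le: "part_length ?nu \<le> la + lb"
      using part_length_iff[OF part, of "la + lb"] by simp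
    show ?thesis
    proof (cases "part_length ?nu = la + lb \<and> card ?Z = \<beta> 0 - 1")
      case True
      then have "?nu (la + 1 + lb - 2) \<noteq> 0"
        using part_length_iff[OF part, of "la + lb - 1"] la_pos lb_pos by simp
      then have ends: "T (i, \<beta> i - 1) = la + 1 + i - 1" if "i < lb" for i
        using row_ends_maximal[OF LR _ row0, of i] that by simp
      have j0_eq: "j0 = \<beta> 0 - 1" using True Zle j0 by linarith
      then have Z: "?Z = {..<\<beta> 0 - 1}" using card_subset_eq[OF _ Zsub] True by simp
      have "T (0, j) = (if j < \<beta> 0 - 1 then 0 else la)" if "j < \<beta> 0" for j
      proof (cases "j < \<beta> 0 - 1")
        case True
        then have "j \<in> ?Z" unfolding Z by simp
        then show ?thesis using True by simp
      next
        case False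
        then have "j = \<beta> 0 - 1" using that by simp
        then show ?thesis using ends[of 0] lb_pos by simp
      qed
      then have "extremal 1 T" using ends by (simp add: extremal_def)
      then show ?thesis by blast
    next
      case False
      then show ?thesis using le Zle nu0 hl j0 la_pos lb_pos by linarith
    qed
  qed
qed

end

subsection \<open>Fillings whose content has maximal diagonal hooks\<close>

definition max_tabs :: "(nat \<Rightarrow> nat) \<Rightarrow> (nat \<Rightarrow> nat) \<Rightarrow> (nat \<times> nat \<Rightarrow> nat) set" where
  "max_tabs \<alpha> \<beta> = {T. LR_tab \<alpha> \<beta> T \<and> hl (content \<alpha> \<beta> T) = (\<lambda>i. hl \<alpha> i + hl \<beta> i)}"

lemma card_row_young_diagram: "card {x \<in> young_diagram \<beta>. fst x = k} = \<beta> k"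
proof -
  have "{x \<in> young_diagram \<beta>. fst x = k} = Pair k ` {..<\<beta> k}" by force
  then show ?thesis by (simp add: card_image inj_on_def)
qed

text \<open>Base case of the induction; the only filling is \<open>\<lambda>_. undefined\<close>
  because fillings are extensional.\<close>

lemma LR_tab_empty_right:
  assumes "is_partition \<alpha>" "is_partition \<beta>" "\<beta> 0 = 0"
  shows "LR_tab \<alpha> \<beta> T \<longleftrightarrow> T = (\<lambda>_. undefined)" and "content \<alpha> \<beta> T = \<alpha>"
proof -
  have "\<beta> i = 0" for i using partition_antimonoD[OF assms(2), of 0 i] assms(3) by simp
  then have "young_diagram \<beta> = {}" by (simp add: young_diagram_def)
  moreover have "\<alpha> (Suc k) \<le> \<alpha> k" for k using partition_antimonoD[OF assms(1)] by simp
  ultimately show "LR_tab \<alpha> \<beta> T \<longleftrightarrow> T = (\<lambda>_. undefined)" "content \<alpha> \<beta> T = \<alpha>"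
    by (auto simp: LR_tab_def semistandard_def count_upto_def content_def)
qed

text \<open>The entries of row \<open>i\<close> are squeezed between \<open>i\<close>, by the
  columns, and \<open>part_length \<alpha> + i\<close>, by the lattice condition.\<close>

lemma LR_tab_empty_left:
  assumes "is_partition \<alpha>" "is_partition \<beta>" "\<alpha> 0 = 0"
  shows "LR_tab \<alpha> \<beta> T \<longleftrightarrow> T = restrict fst (young_diagram \<beta>)"
    and "content \<alpha> \<beta> (restrict fst (young_diagram \<beta>)) = \<beta>"
proof -
  let ?D = "young_diagram \<beta>"
  let ?T = "restrict fst ?D"
  have a: "\<alpha> i = 0" for i using partition_antimonoD[OF assms(1), of 0 i] assms(3) by simp
  have cnt: "{x \<in> ?D. P x \<and> ?T x = k} = {x \<in> ?D. P x \<and> fst x = k}" for P k by auto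
  show "content \<alpha> \<beta> ?T = \<beta>"
  proof
    fix k show "content \<alpha> \<beta> ?T k = \<beta> k"
      using cnt[of "\<lambda>_. True" k] a by (simp add: content_def card_row_young_diagram)
  qed
  have "T x = ?T x" if "LR_tab \<alpha> \<beta> T" "x \<in> ?D" for x
  proof (cases x)
    case (Pair i j)
    have "i \<le> T (i, j)"
      using semistandard_ge_row[OF _ assms(2)] that Pair by (auto simp: LR_tab_def)
    moreover have "T (i, j) \<le> part_length \<alpha> + i"
      using LR_tab_le[OF that(1) assms(1,2)] that Pair by blast
    moreover have "part_length \<alpha> = 0" by (rule part_length_eqI) (simp add: a)
    ultimately show ?thesis using that Pair by simp
  qed
  then have "T = ?T" if "LR_tab \<alpha> \<beta> T"
    using that by (intro extensionalityI[where A = ?D]) (auto simp: LR_tab_def)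
  moreover have "LR_tab \<alpha> \<beta> ?T"
  proof -
    have "count_upto ?D ?T (Suc n) (Suc k) \<le> count_upto ?D ?T n k" for n k
    \<comment> \<open>Either rows \<open>k\<close> and \<open>Suc k\<close> have both been read
      completely, or row \<open>Suc k\<close> has not been reached.\<close>
    proof (cases "k < n")
      case True
      then have "{x \<in> ?D. fst x < Suc n \<and> ?T x = Suc k} = {x \<in> ?D. fst x = Suc k}"
        "{x \<in> ?D. fst x < n \<and> ?T x = k} = {x \<in> ?D. fst x = k}" by auto
      then show ?thesis
        using partition_antimonoD[OF assms(2), of k "Suc k"]
        by (simp add: count_upto_def card_row_young_diagram)
    next
      case False
      then have "{x \<in> ?D. fst x < Suc n \<and> ?T x = Suc k} = {}" by auto
      then show ?thesis by (simp only: count_upto_def card.empty)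
    qed
    then show ?thesis by (auto simp: LR_tab_def a semistandard_def)
  qed
  ultimately show "LR_tab \<alpha> \<beta> T \<longleftrightarrow> T = ?T" by blast
qed

text \<open>Induction on the length of \<alpha>, which peeling decreases. If a shape is empty there
  is one filling; otherwise the maximal fillings correspond to pairs of a bit \<open>c\<close> and a
  maximal filling of the peeled shapes. Injectivity of \<open>content\<close> is carried along
  because it yields multiplicity 1.\<close>

lemma LR_tab_hl_max:
  assumes "is_partition \<alpha>" "is_partition \<beta>"
  shows "(\<forall>T. LR_tab \<alpha> \<beta> T \<longrightarrow> T \<in> max_tabs \<alpha> \<beta> \<or>
              less_fun (hl (content \<alpha> \<beta> T)) (\<lambda>i. hl \<alpha> i + hl \<beta> i)) \<and>
         card (max_tabs \<alpha> \<beta>) = 2 ^ min (durfee \<alpha>) (durfee \<beta>) \<and>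
         inj_on (content \<alpha> \<beta>) (max_tabs \<alpha> \<beta>)"
  using assms
proof (induction "part_length \<alpha>" arbitrary: \<alpha> \<beta> rule: less_induct)
  case less
  note part = less.prems
  show ?case
  proof (cases "\<alpha> 0 = 0 \<or> \<beta> 0 = 0")
    case True
    have "\<exists>T0. (\<forall>T. LR_tab \<alpha> \<beta> T \<longleftrightarrow> T = T0) \<and> hl (content \<alpha> \<beta> T0) = (\<lambda>i. hl \<alpha> i + hl \<beta> i)"
    proof (cases "\<alpha> 0 = 0")
      case True
      then show ?thesis using LR_tab_empty_left[OF part True] hl_eq_0[OF part(1) True] by auto
    next
      case False
      then have "\<beta> 0 = 0" using \<open>\<alpha> 0 = 0 \<or> \<beta> 0 = 0\<close> by simp
      then show ?thesis using LR_tab_empty_right[OF part] hl_eq_0[OF part(2)] by auto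
    qed
    then obtain T0 where T0: "\<And>T. LR_tab \<alpha> \<beta> T \<longleftrightarrow> T = T0"
      "hl (content \<alpha> \<beta> T0) = (\<lambda>i. hl \<alpha> i + hl \<beta> i)" by blast
    then have "max_tabs \<alpha> \<beta> = {T0}" by (auto simp: max_tabs_def)
    moreover have "min (durfee \<alpha>) (durfee \<beta>) = 0" using True durfee_0[of \<alpha>] durfee_0[of \<beta>] by auto
    ultimately show ?thesis using T0 by simp
  next
    case False
    then interpret nonempty_partitions \<alpha> \<beta> by unfold_locales (use part in auto)
    let ?h = "\<lambda>i. hl \<alpha> i + hl \<beta> i" and ?h' = "\<lambda>i. hl (peel \<alpha>) i + hl (peel \<beta>) i"
    let ?M = "max_tabs \<alpha> \<beta>" and ?M' = "max_tabs (peel \<alpha>) (peel \<beta>)"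
    note IH = less.hyps[OF part_length_peel_a peel_partition[OF part_a] peel_partition[OF part_b]]
    have hl': "hl (content \<alpha> \<beta> T) (Suc i) = hl (content (peel \<alpha>) (peel \<beta>) (peel_tab T)) i"
      if "LR_tab \<alpha> \<beta> T" "extremal c T" "c \<le> 1" for T c i
      using peel_content_extremal[OF that] by (simp add: hl_Suc)
    \<comment> \<open>Entry 0 is settled by \<open>hl_0_extremal\<close>, so only the entries
      shifted by \<open>hl_Suc\<close> remain to be compared.\<close>
    have max_iff: "T \<in> ?M \<longleftrightarrow> peel_tab T \<in> ?M'" if "LR_tab \<alpha> \<beta> T" "extremal c T" "c \<le> 1" for T c
    proof -
      have "hl (content \<alpha> \<beta> T) = ?h \<longleftrightarrow> (\<forall>i. hl (content \<alpha> \<beta> T) (Suc i) = ?h (Suc i))"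
      proof (safe)
        assume a: "\<forall>i. hl (content \<alpha> \<beta> T) (Suc i) = ?h (Suc i)"
        show "hl (content \<alpha> \<beta> T) = ?h"
        proof
          fix i show "hl (content \<alpha> \<beta> T) i = ?h i"
            using a hl_0_extremal[OF that] by (cases i) auto
        qed
      qed simp
      also have "\<dots> \<longleftrightarrow> hl (content (peel \<alpha>) (peel \<beta>) (peel_tab T)) = ?h'"
        unfolding hl_Suc peel_content_extremal[OF that] fun_eq_iff ..
      finally show ?thesis using LR_tab_peel[OF that] that(1) by (simp add: max_tabs_def)
    qed
    have ex_c: "\<exists>c\<le>1. extremal c T" if "T \<in> ?M" for T
      using hl_0_le_or_extremal[of T] that by (auto simp: max_tabs_def)
    have "T \<in> ?M \<or> less_fun (hl (content \<alpha> \<beta> T)) ?h" if LR: "LR_tab \<alpha> \<beta> T" for T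
    proof (cases "hl (content \<alpha> \<beta> T) 0 < ?h 0")
      case True
      then show ?thesis unfolding less_fun_def by auto
    next
      case False
      then obtain c where c: "c \<le> 1" "extremal c T" using hl_0_le_or_extremal[OF LR] by auto
      \<comment> \<open>As the entries 0 agree, a first difference at \<open>k\<close> in the peeled
        sequences becomes one at \<open>Suc k\<close>.\<close>
      have "less_fun (hl (content \<alpha> \<beta> T)) ?h"
        if lt: "less_fun (hl (content (peel \<alpha>) (peel \<beta>) (peel_tab T))) ?h'"
      proof -
        obtain k where k: "hl (content (peel \<alpha>) (peel \<beta>) (peel_tab T)) k < ?h' k"
          "\<And>k'. k' < k \<Longrightarrow> hl (content (peel \<alpha>) (peel \<beta>) (peel_tab T)) k' = ?h' k'"
          using lt unfolding less_fun_def by blast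
        have "hl (content \<alpha> \<beta> T) (Suc k) < ?h (Suc k)"
          using k(1) hl'[OF LR c(2,1)] by (simp add: hl_Suc)
        moreover have "hl (content \<alpha> \<beta> T) k' = ?h k'" if "k' < Suc k" for k'
          using that k(2) hl'[OF LR c(2,1)] hl_0_extremal[OF LR c(2,1)]
          by (cases k') (auto simp: hl_Suc)
        ultimately show ?thesis unfolding less_fun_def by blast
      qed
      then show ?thesis using IH LR_tab_peel[OF LR c(2,1)] max_iff[OF LR c(2,1)] by blast
    qed
    moreover have "card ?M = 2 ^ min (durfee \<alpha>) (durfee \<beta>)"
    proof -
      let ?f = "\<lambda>(c, T'). extend_tab c T'"
      have mem': "T' \<in> extensional (young_diagram (peel \<beta>))" "LR_tab (peel \<alpha>) (peel \<beta>) T'"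
        if "T' \<in> ?M'" for T' using that by (auto simp: max_tabs_def LR_tab_def)
      have "inj_on ?f ({..1} \<times> ?M')"
      proof (rule inj_onI)
        fix p p' assume p: "p \<in> {..1} \<times> ?M'" "p' \<in> {..1} \<times> ?M'" "?f p = ?f p'"
        obtain c T c' T' where p_eq: "p = (c, T)" "p' = (c', T')" by (cases p, cases p')
        then have *: "c \<in> {..1}" "T \<in> ?M'" "c' \<in> {..1}" "T' \<in> ?M'" "extend_tab c T = extend_tab c' T'"
          using p by auto
        \<comment> \<open>The first part of \<nu> reveals the bit \<open>c\<close>.\<close>
        have "content \<alpha> \<beta> (extend_tab c T) 0 = \<alpha> 0 + \<beta> 0 - c" "content \<alpha> \<beta> (extend_tab c' T') 0 = \<alpha> 0 + \<beta> 0 - c'"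
          using content_extremal(2)[OF LR_tab_extend extremal_extend_tab] mem'(2) *(1-4) by auto
        then have "\<alpha> 0 + \<beta> 0 - c = \<alpha> 0 + \<beta> 0 - c'" using *(5) by simp
        then have "c = c'" using *(1,3) b_pos by auto
        moreover have "T = T'"
          using peel_extend_tab[OF mem'(1)[OF *(2)], of c] peel_extend_tab[OF mem'(1)[OF *(4)], of c'] *(5) by simp
        ultimately show "p = p'" using p_eq by simp
      qed
      moreover have "?f ` ({..1} \<times> ?M') = ?M"
      proof (intro equalityI subsetI)
        fix T assume "T \<in> ?f ` ({..1} \<times> ?M')"
        then obtain c T' where *: "T = extend_tab c T'" "c \<le> 1" "T' \<in> ?M'" by auto
        then show "T \<in> ?M"
          using max_iff[OF LR_tab_extend[OF mem'(2)] extremal_extend_tab] peel_extend_tab[OF mem'(1)] by simp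
      next
        fix T assume T: "T \<in> ?M"
        then obtain c where c: "c \<le> 1" "extremal c T" using ex_c by blast
        have LR: "LR_tab \<alpha> \<beta> T" using T by (simp add: max_tabs_def)
        have "T = ?f (c, peel_tab T)" using extend_peel_tab[OF LR c(2)] by simp
        moreover have "peel_tab T \<in> ?M'" using max_iff[OF LR c(2,1)] T by simp
        ultimately show "T \<in> ?f ` ({..1} \<times> ?M')" using c(1) by blast
      qed
      ultimately have "card ?M = card ({..1::nat} \<times> ?M')" by (metis card_image)
      also have "\<dots> = 2 * card ?M'" by (simp add: card_cartesian_product)
      also have "\<dots> = 2 ^ Suc (min (durfee (peel \<alpha>)) (durfee (peel \<beta>)))" using IH by simp
      finally show ?thesis using durfee_peel[OF part_a a_pos] durfee_peel[OF part_b b_pos] by simp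
    qed
    moreover have "inj_on (content \<alpha> \<beta>) ?M"
    proof (rule inj_onI)
      fix T1 T2 assume T: "T1 \<in> ?M" "T2 \<in> ?M" and eq: "content \<alpha> \<beta> T1 = content \<alpha> \<beta> T2"
      have LR: "LR_tab \<alpha> \<beta> T1" "LR_tab \<alpha> \<beta> T2" using T by (auto simp: max_tabs_def)
      obtain c1 where c1: "c1 \<le> 1" "extremal c1 T1" using ex_c T by blast
      obtain c2 where c2: "c2 \<le> 1" "extremal c2 T2" using ex_c T by blast
      have "c1 = c2"
        using content_extremal(2)[OF LR(1) c1(2,1)] content_extremal(2)[OF LR(2) c2(2,1)] eq c1 c2 b_pos by simp
      moreover have "peel_tab T1 = peel_tab T2"
      proof (rule inj_onD)
        show "inj_on (content (peel \<alpha>) (peel \<beta>)) ?M'" using IH by blast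
        show "content (peel \<alpha>) (peel \<beta>) (peel_tab T1) = content (peel \<alpha>) (peel \<beta>) (peel_tab T2)"
          using peel_content_extremal[OF LR(1) c1(2,1)] peel_content_extremal[OF LR(2) c2(2,1)] eq by simp
      qed (use max_iff[OF LR(1) c1(2,1)] max_iff[OF LR(2) c2(2,1)] T in auto)
      ultimately show "T1 = T2"
        using extend_peel_tab[OF LR(1) c1(2)] extend_peel_tab[OF LR(2) c2(2)] by metis
    qed
    ultimately show ?thesis by blast
  qed
qed

subsection \<open>Skew diagrams with two disconnected pieces\<close>

lemma mem_shift_set [simp]:
  "(x, y) \<in> shift_set a b D \<longleftrightarrow> a \<le> x \<and> b \<le> y \<and> (x - a, y - b) \<in> D"
  by (force simp: shift_set_def image_iff)

lemma card_shift_set: "card (shift_set a b D) = card D"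
  unfolding shift_set_def by (intro card_image) (auto simp: inj_on_def)

lemma finite_shift_set: "finite D \<Longrightarrow> finite (shift_set a b D)"
  by (simp add: shift_set_def)

lemma count_upto_mono: "finite D \<Longrightarrow> m \<le> n \<Longrightarrow> count_upto D T m k \<le> count_upto D T n k"
  unfolding count_upto_def by (rule card_mono) auto

text \<open>The condition is tightest right after the leftmost \<open>Suc k\<close> of a row: by
  semistandardness all letters \<open>Suc k\<close> of that row have then been read and none of its
  letters \<open>k\<close>.\<close>

lemma lattice_filling_iff_rows:
  assumes fin: "finite A" and ss: "semistandard A T"
  shows "lattice_filling A T \<longleftrightarrow>
    (\<forall>n k. count_upto A T (Suc n) (Suc k) \<le> count_upto A T n k)"
proof -
  have fin': "finite (read_upto A b)" for b
    by (rule finite_subset[OF _ fin]) (auto simp: read_upto_def)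
  show ?thesis
  proof
    assume lat: "lattice_filling A T"
    have attained: "count_upto A T (Suc n) (Suc k) \<le> count_upto A T n k"
      if ex: "\<exists>j. (n, j) \<in> A \<and> T (n, j) = Suc k" for n k
    proof -
      define j where "j = (LEAST j. (n, j) \<in> A \<and> T (n, j) = Suc k)"
      have j: "(n, j) \<in> A" "T (n, j) = Suc k" using LeastI_ex[OF ex] by (auto simp: j_def)
      have least: "j \<le> j'" if "(n, j') \<in> A" "T (n, j') = Suc k" for j'
        unfolding j_def by (rule Least_le) (use that in simp)
      have "{x \<in> A. fst x < Suc n \<and> T x = Suc k} \<subseteq> {x \<in> read_upto A (n, j). T x = Suc k}"
        using least by (fastforce simp: read_upto_def less_Suc_eq)
      then have "count_upto A T (Suc n) (Suc k) \<le> card {x \<in> read_upto A (n, j). T x = Suc k}"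
        unfolding count_upto_def using fin' by (intro card_mono) simp_all
      also have "\<dots> \<le> card {x \<in> read_upto A (n, j). T x = k}"
        using lat j(1) unfolding lattice_filling_def by blast
      also have "\<dots> \<le> count_upto A T n k"
        unfolding count_upto_def
      proof (rule card_mono)
        show "{x \<in> read_upto A (n, j). T x = k} \<subseteq> {x \<in> A. fst x < n \<and> T x = k}"
          using semistandard_rowD[OF ss j(1)] j(2) by (fastforce simp: read_upto_def)
      qed (use fin in simp)
      finally show ?thesis .
    qed
    \<comment> \<open>Rows lacking the letter \<open>Suc k\<close> inherit the inequality from the
      row above.\<close>
    have "count_upto A T (Suc n) (Suc k) \<le> count_upto A T n k" for n k
    proof (induction n)
      case 0
      show ?case
      proof (cases "\<exists>j. (0, j) \<in> A \<and> T (0, j) = Suc k")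
        case False
        then have "{x \<in> A. fst x < Suc 0 \<and> T x = Suc k} = {}" by auto
        then show ?thesis by (simp only: count_upto_def card.empty)
      qed (rule attained)
    next
      case (Suc n)
      show ?case
      proof (cases "\<exists>j. (Suc n, j) \<in> A \<and> T (Suc n, j) = Suc k")
        case False
        then have "{x \<in> A. fst x < Suc (Suc n) \<and> T x = Suc k} = {x \<in> A. fst x < Suc n \<and> T x = Suc k}"
          by (auto simp: less_Suc_eq)
        then have "count_upto A T (Suc (Suc n)) (Suc k) = count_upto A T (Suc n) (Suc k)"
          by (simp only: count_upto_def)
        also have "\<dots> \<le> count_upto A T (Suc n) k"
          using Suc.IH count_upto_mono[OF fin, of n "Suc n" T k] by simp
        finally show ?thesis .
      qed (rule attained)
    qed
    then show "\<forall>n k. count_upto A T (Suc n) (Suc k) \<le> count_upto A T n k" by blast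
  next
    assume rows: "\<forall>n k. count_upto A T (Suc n) (Suc k) \<le> count_upto A T n k"
    show "lattice_filling A T"
      unfolding lattice_filling_def
    proof (intro ballI allI)
      fix b k assume "b \<in> A"
      let ?R = "\<lambda>k. {x \<in> read_upto A b. T x = k}"
      \<comment> \<open>The prefix up to \<open>b\<close> contains at most the letters
        \<open>Suc k\<close> through the row of \<open>b\<close>, and at least the letters
        \<open>k\<close> of all rows above it.\<close>
      have "card (?R (Suc k)) \<le> count_upto A T (Suc (fst b)) (Suc k)"
        unfolding count_upto_def by (rule card_mono) (auto simp: fin read_upto_def)
      also have "\<dots> \<le> count_upto A T (fst b) k" using rows by blast
      also have "\<dots> \<le> card (?R k)"
        unfolding count_upto_def
      proof (rule card_mono)
        show "finite (?R k)" using fin' by simp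
      qed (auto simp: read_upto_def)
      finally show "card (?R (Suc k)) \<le> card (?R k)" .
    qed
  qed
qed

lemma finite_LR_tab:
  assumes "is_partition \<alpha>" "is_partition \<beta>"
  shows "finite {T. LR_tab \<alpha> \<beta> T}"
proof (rule finite_subset)
  let ?D = "young_diagram \<beta>" and ?N = "part_length \<alpha> + part_length \<beta>"
  show "{T. LR_tab \<alpha> \<beta> T} \<subseteq> PiE ?D (\<lambda>_. {..?N})"
  proof
    fix T assume "T \<in> {T. LR_tab \<alpha> \<beta> T}"
    then have LR: "LR_tab \<alpha> \<beta> T" by simp
    have "T x \<le> ?N" if "x \<in> ?D" for x
    proof (cases x)
      case (Pair i j)
      then show ?thesis
        using LR_tab_le[OF LR assms] young_diagram_row[OF _ assms(2)] that by fastforce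
    qed
    then show "T \<in> PiE ?D (\<lambda>_. {..?N})" using LR by (auto simp: LR_tab_def PiE_def)
  qed
  show "finite (PiE ?D (\<lambda>_. {..?N}))"
    using finite_young_diagram[OF assms(2)] by (intro finite_PiE) auto
qed

section \<open>Northwest ribbons as diagonal hooks\<close>

definition diag_core :: "(nat \<Rightarrow> nat) \<Rightarrow> nat \<Rightarrow> (nat \<times> nat) set" where
  "diag_core lam k = {(i, j). j < lam i \<and> k \<le> i \<and> k \<le> j}"

text \<open>Like \<open>diag_core\<close>, and unlike \<open>peel\<close>, this keeps the original
  coordinates, since ribbons are removed from a translated diagram in place.\<close>

definition diag_hook :: "(nat \<Rightarrow> nat) \<Rightarrow> nat \<Rightarrow> (nat \<times> nat) set" where
  "diag_hook lam k = {(i, j). j < lam i \<and> k \<le> i \<and> k \<le> j \<and> (i = k \<or> j = k)}"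

lemma card_diag_hook:
  assumes "is_partition lam"
  shows "card (diag_hook lam k) = hl lam k"
proof (cases "k < lam k")
  case True
  have "diag_hook lam k = hook lam (k, k)" by (auto simp: diag_hook_def hook_def)
  then show ?thesis using True by (simp add: hl_def)
next
  case False
  have "\<not> j < lam i" if "k \<le> i" "k \<le> j" for i j
    using partition_antimonoD[OF assms that(1)] that(2) False by simp
  then have "diag_hook lam k = {}" by (auto simp: diag_hook_def)
  then show ?thesis using False by (simp add: hl_def)
qed

lemma finite_diag_hook: "is_partition lam \<Longrightarrow> finite (diag_hook lam k)"
  by (rule finite_subset[OF _ finite_young_diagram]) (auto simp: diag_hook_def)

lemma diag_hook_subset: "diag_hook lam k \<subseteq> diag_core lam k"
  by (auto simp: diag_core_def diag_hook_def)

text \<open>A box with both coordinates beyond \<open>k\<close> has its northwest neighbour in the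
  core because higher rows are at least as long; a box in row or column \<open>k\<close> has none
  there. The alternatives \<open>x = 0\<close> and \<open>y = 0\<close> guard against truncated
  subtraction.\<close>

lemma nw_neighbour_diag_core:
  assumes part: "is_partition lam" and mem: "(x, y) \<in> shift_set a b (diag_core lam k)"
  shows "x = 0 \<or> y = 0 \<or> (x - 1, y - 1) \<notin> shift_set a b (diag_core lam k) \<longleftrightarrow>
    (x, y) \<in> shift_set a b (diag_hook lam k)"
proof -
  obtain i j where ij: "x = i + a" "y = j + b" "j < lam i" "k \<le> i" "k \<le> j"
    using mem by (auto simp: shift_set_def diag_core_def)
  show ?thesis
  proof (cases "k < i \<and> k < j")
    case True
    then obtain i' j' where i'j': "i = Suc i'" "j = Suc j'" by (metis gr0_implies_Suc less_zeroE not_gr0)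
    have "j' < lam i'" using partition_antimonoD[OF part, of i' i] ij(3) i'j' by simp
    then show ?thesis using True ij i'j' by (simp add: diag_core_def diag_hook_def)
  next
    case False
    then have "i = k \<or> j = k" using ij by auto
    then show ?thesis using ij by (auto simp: diag_core_def diag_hook_def)
  qed
qed

text \<open>The assumptions \<open>rows\<close> and \<open>cols\<close> put \<open>B\<close>
  entirely above and to the right of \<open>C\<close>, so the tableau word exhausts \<open>B\<close>
  first. Up to exchanging the pieces, \<open>two_pieces_of_disconnected\<close> derives this
  position.\<close>

locale two_pieces =
  fixes \<alpha> \<beta> :: "nat \<Rightarrow> nat" and a b c d :: nat
  assumes part_a: "is_partition \<alpha>" and part_b: "is_partition \<beta>"
    and rows: "a + part_length \<alpha> \<le> c" and cols: "d + \<beta> 0 \<le> b"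
begin

abbreviation "B \<equiv> shift_set a b (young_diagram \<alpha>)"
abbreviation "C \<equiv> shift_set c d (young_diagram \<beta>)"
abbreviation "A \<equiv> B \<union> C"

lemma B_row: "(x, y) \<in> B \<Longrightarrow> x < c \<and> a \<le> x \<and> b \<le> y"
  using rows young_diagram_row[OF _ part_a, of "x - a" "y - b"] by auto

lemma C_row: "(x, y) \<in> C \<Longrightarrow> c \<le> x \<and> d \<le> y \<and> y < b"
  using cols partition_antimonoD[OF part_b, of 0 "x - c"] by auto

lemma B_C_disjoint: "B \<inter> C = {}"
  using B_row C_row by (metis disjoint_iff not_less surj_pair)

lemma same_row: "(x, y) \<in> A \<Longrightarrow> (x, y') \<in> A \<Longrightarrow> (x, y) \<in> B \<longleftrightarrow> (x, y') \<in> B"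
  using B_row[of x y] B_row[of x y'] C_row[of x y] C_row[of x y'] by (metis UnE not_less)

lemma same_col: "(x, y) \<in> A \<Longrightarrow> (x', y) \<in> A \<Longrightarrow> (x, y) \<in> B \<longleftrightarrow> (x', y) \<in> B"
  using B_row[of x y] B_row[of x' y] C_row[of x y] C_row[of x' y] by (metis UnE not_less)

lemma finite_A: "finite A"
  using finite_shift_set finite_young_diagram part_a part_b by simp

text \<open>On \<open>B\<close> the entry \<open>x - a\<close> is the only possible one, as
  \<open>LR_filling_B\<close> shows.\<close>

definition glue :: "(nat \<times> nat \<Rightarrow> nat) \<Rightarrow> nat \<times> nat \<Rightarrow> nat" where
  "glue T = restrict (\<lambda>(x, y). if (x, y) \<in> B then x - a else T (x - c, y - d)) A"

definition unglue :: "(nat \<times> nat \<Rightarrow> nat) \<Rightarrow> nat \<times> nat \<Rightarrow> nat" where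
  "unglue U = restrict (\<lambda>(i, j). U (i + c, j + d)) (young_diagram \<beta>)"

lemma glue_B: "(i, j) \<in> young_diagram \<alpha> \<Longrightarrow> glue T (i + a, j + b) = i"
  by (simp add: glue_def)

lemma glue_C:
  assumes "(i, j) \<in> young_diagram \<beta>"
  shows "glue T (i + c, j + d) = T (i, j)"
proof -
  have "(i + c, j + d) \<in> C" using assms by simp
  moreover then have "(i + c, j + d) \<notin> B" using B_C_disjoint by blast
  ultimately show ?thesis unfolding glue_def restrict_def by (simp del: mem_shift_set)
qed

text \<open>Stated for any \<open>U\<close> with the prescribed values, so that it serves both glued
  and given fillings. The row predicate \<open>P\<close> covers the running counts and, as the
  constant \<open>True\<close>, the whole content.\<close>

lemma card_glue:
  assumes UB: "\<And>i j. (i, j) \<in> young_diagram \<alpha> \<Longrightarrow> U (i + a, j + b) = i"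
    and UC: "\<And>i j. (i, j) \<in> young_diagram \<beta> \<Longrightarrow> U (i + c, j + d) = T (i, j)"
  shows "card {x \<in> A. P (fst x) \<and> U x = k} =
    (if P (k + a) then \<alpha> k else 0) + card {x \<in> young_diagram \<beta>. P (fst x + c) \<and> T x = k}"
proof -
  let ?X = "if P (k + a) then {x \<in> young_diagram \<alpha>. fst x = k} else {}"
  let ?Y = "{x \<in> young_diagram \<beta>. P (fst x + c) \<and> T x = k}"
  have "{x \<in> B. P (fst x) \<and> U x = k} = shift_set a b ?X"
    unfolding shift_set_def using UB by (auto split: if_splits)
  moreover have "{x \<in> C. P (fst x) \<and> U x = k} = shift_set c d ?Y"
    unfolding shift_set_def using UC by auto
  moreover have "{x \<in> A. P (fst x) \<and> U x = k} = {x \<in> B. P (fst x) \<and> U x = k} \<union> {x \<in> C. P (fst x) \<and> U x = k}"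
    by blast
  moreover have "card ({x \<in> B. P (fst x) \<and> U x = k} \<union> {x \<in> C. P (fst x) \<and> U x = k})
      = card {x \<in> B. P (fst x) \<and> U x = k} + card {x \<in> C. P (fst x) \<and> U x = k}"
    using B_C_disjoint finite_A by (intro card_Un_disjoint) auto
  ultimately show ?thesis by (simp add: card_shift_set card_row_young_diagram)
qed

lemma count_glue:
  assumes "\<And>i j. (i, j) \<in> young_diagram \<alpha> \<Longrightarrow> U (i + a, j + b) = i"
    and "\<And>i j. (i, j) \<in> young_diagram \<beta> \<Longrightarrow> U (i + c, j + d) = T (i, j)"
  shows "count_upto A U n k = (if k + a < n then \<alpha> k else 0) + count_upto (young_diagram \<beta>) T (n - c) k"
  using card_glue[of U T, OF assms, of "\<lambda>x. x < n" k] by (simp add: count_upto_def less_diff_conv)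

lemma glue_rows_iff:
  assumes "\<And>i j. (i, j) \<in> young_diagram \<alpha> \<Longrightarrow> U (i + a, j + b) = i"
    and "\<And>i j. (i, j) \<in> young_diagram \<beta> \<Longrightarrow> U (i + c, j + d) = T (i, j)"
  shows "(\<forall>n k. count_upto A U (Suc n) (Suc k) \<le> count_upto A U n k) \<longleftrightarrow>
    (\<forall>n k. \<alpha> (Suc k) + count_upto (young_diagram \<beta>) T (Suc n) (Suc k)
            \<le> \<alpha> k + count_upto (young_diagram \<beta>) T n k)" (is "?L \<longleftrightarrow> ?R")
proof -
  note cnt = count_glue[of U T, OF assms]
  \<comment> \<open>By row \<open>c\<close> all of \<alpha> has been read, so from there on both
    conditions agree up to a shift of rows. Above row \<open>c\<close> only the monotonicity of
    \<alpha> is at stake.\<close>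
  have full: "(if k + a < n + c then \<alpha> k else 0) = \<alpha> k" for n k
    using part_length_iff[OF part_a, of k] rows by auto
  have cnt': "count_upto A U (n + c) k = \<alpha> k + count_upto (young_diagram \<beta>) T n k" for n k
    using cnt[of "n + c" k] unfolding full by simp
  show ?thesis
  proof
    assume L: ?L
    show ?R
    proof (intro allI)
      fix n k
      show "\<alpha> (Suc k) + count_upto (young_diagram \<beta>) T (Suc n) (Suc k)
            \<le> \<alpha> k + count_upto (young_diagram \<beta>) T n k"
        using L[rule_format, of "n + c" k] cnt'[of n k] cnt'[of "Suc n" "Suc k"] by simp
    qed
  next
    assume R: ?R
    show ?L
    proof (intro allI)
      fix n k
      show "count_upto A U (Suc n) (Suc k) \<le> count_upto A U n k"
      proof (cases "c \<le> n")
        case True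
        then obtain m where "n = m + c" by (metis add.commute le_Suc_ex)
        then show ?thesis using R[rule_format, of k m] cnt'[of m k] cnt'[of "Suc m" "Suc k"] by simp
      next
        case False
        then have "Suc n - c = 0" "n - c = 0" by auto
        then show ?thesis
          using cnt[of "Suc n" "Suc k"] cnt[of n k] partition_antimonoD[OF part_a, of k "Suc k"] by simp
      qed
    qed
  qed
qed

lemma semistandard_glue_iff:
  assumes UB: "\<And>i j. (i, j) \<in> young_diagram \<alpha> \<Longrightarrow> U (i + a, j + b) = i"
    and UC: "\<And>i j. (i, j) \<in> young_diagram \<beta> \<Longrightarrow> U (i + c, j + d) = T (i, j)"
  shows "semistandard A U \<longleftrightarrow> semistandard (young_diagram \<beta>) T"
proof
  assume U: "semistandard A U"
  have mem: "(i + c, j + d) \<in> A" if "(i, j) \<in> young_diagram \<beta>" for i j using that by simp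
  show "semistandard (young_diagram \<beta>) T"
    unfolding semistandard_def
  proof (intro conjI allI impI; elim conjE)
    fix i j j' assume "(i, j) \<in> young_diagram \<beta>" "(i, j') \<in> young_diagram \<beta>" "j < j'"
    then show "T (i, j) \<le> T (i, j')"
      using semistandard_rowD[OF U mem mem, of i j j'] UC by simp
  next
    fix i i' j assume "(i, j) \<in> young_diagram \<beta>" "(i', j) \<in> young_diagram \<beta>" "i < i'"
    then show "T (i, j) < T (i', j)"
      using semistandard_colD[OF U mem mem, of i j i'] UC by simp
  qed
next
  assume T: "semistandard (young_diagram \<beta>) T"
  have B: "U (x, y) = x - a" if "(x, y) \<in> B" for x y
    using UB[of "x - a" "y - b"] that by simp
  have C: "U (x, y) = T (x - c, y - d)" if "(x, y) \<in> C" for x y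
    using UC[of "x - c" "y - d"] that by simp
  show "semistandard A U"
    unfolding semistandard_def
  proof (intro conjI allI impI; elim conjE)
    fix x y y' assume xy: "(x, y) \<in> A" "(x, y') \<in> A" "y < y'"
    show "U (x, y) \<le> U (x, y')"
    proof (cases "(x, y) \<in> B")
      case True
      then have "(x, y') \<in> B" using same_row[OF xy(1,2)] by blast
      then show ?thesis using B True by simp
    next
      case False
      then have C': "(x, y) \<in> C" "(x, y') \<in> C" using same_row[OF xy(1,2)] xy by blast+
      then show ?thesis using C[OF C'(1)] C[OF C'(2)] xy(3)
          semistandard_rowD[OF T, of "x - c" "y - d" "y' - d"] by simp
    qed
  next
    fix x x' y assume xy: "(x, y) \<in> A" "(x', y) \<in> A" "x < x'"
    show "U (x, y) < U (x', y)"
    proof (cases "(x, y) \<in> B")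
      case True
      then have B': "(x', y) \<in> B" using same_col[OF xy(1,2)] by blast
      then show ?thesis using B[OF B'] B[OF True] B_row[OF True] B_row[OF B'] xy(3) by simp
    next
      case False
      then have C': "(x, y) \<in> C" "(x', y) \<in> C" using same_col[OF xy(1,2)] xy by blast+
      then have "x - c < x' - c" using C_row[OF C'(1)] xy(3) by linarith
      then show ?thesis using C' C[OF C'(1)] C[OF C'(2)]
          semistandard_colD[OF T, of "x - c" "y - d" "x' - c"] by simp
    qed
  qed
qed

text \<open>Columns force the entries of row \<open>i\<close> to be at least \<open>i\<close>. A
  larger letter \<open>Suc k\<close> would need a \<open>k \<ge> i\<close> in a higher row, still
  within \<open>B\<close>, where by induction the entries are smaller than \<open>i\<close>.\<close>

lemma LR_filling_B:
  assumes ss: "semistandard A U" and lat: "lattice_filling A U"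
    and ij: "(i, j) \<in> young_diagram \<alpha>"
  shows "U (i + a, j + b) = i"
proof -
  let ?T = "\<lambda>(i, j). U (i + a, j + b)"
  have mem: "(i + a, j + b) \<in> A" if "(i, j) \<in> young_diagram \<alpha>" for i j using that by simp
  have "semistandard (young_diagram \<alpha>) ?T"
    unfolding semistandard_def
  proof (intro conjI allI impI; elim conjE)
    fix i j j' assume "(i, j) \<in> young_diagram \<alpha>" "(i, j') \<in> young_diagram \<alpha>" "j < j'"
    then show "?T (i, j) \<le> ?T (i, j')"
      using semistandard_rowD[OF ss mem mem, of i j j'] by simp
  next
    fix i i' j assume "(i, j) \<in> young_diagram \<alpha>" "(i', j) \<in> young_diagram \<alpha>" "i < i'"
    then show "?T (i, j) < ?T (i', j)"
      using semistandard_colD[OF ss mem mem, of i j i'] by simp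
  qed
  then have ge: "i \<le> U (i + a, j + b)" using semistandard_ge_row[OF _ part_a ij] by fastforce
  have "U (i + a, j + b) \<le> i" using ij
  proof (induction i arbitrary: j rule: less_induct)
    case (less i)
    show ?case
    proof (rule ccontr)
      assume "\<not> U (i + a, j + b) \<le> i"
      then obtain k where k: "U (i + a, j + b) = Suc k" "i \<le> k" by (metis Suc_le_D Suc_le_mono not_less_eq_eq)
      have "0 < count_upto A U (Suc (i + a)) (Suc k)"
        by (rule count_upto_pos[OF finite_A mem[OF less.prems]]) (use k in auto)
      also have "\<dots> \<le> count_upto A U (i + a) k"
        using lattice_filling_iff_rows[OF finite_A ss] lat by blast
      finally obtain x y where xy: "(x, y) \<in> A" "x < i + a" "U (x, y) = k"
        using count_upto_posD by blast
      have "i + a < c" using young_diagram_row[OF less.prems part_a] rows by simp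
      then have "\<not> c \<le> x" using xy(2) by linarith
      then have "(x, y) \<in> B" using xy(1) C_row[of x y] by blast
      then have ge: "a \<le> x" "b \<le> y" and D: "(x - a, y - b) \<in> young_diagram \<alpha>" by simp_all
      then have "x - a < i" using xy(2) by linarith
      then have "U (x, y) \<le> x - a" using less.IH[OF _ D] ge by simp
      with xy(3) k(2) \<open>x - a < i\<close> show False by simp
    qed
  qed
  with ge show ?thesis by simp
qed

lemma LR_coeff_eq_card_LR_tab:
  assumes "skew_diagram lam mu = A"
  shows "LR_coeff lam mu nu = card {T. LR_tab \<alpha> \<beta> T \<and> content \<alpha> \<beta> T = nu}"
proof -
  let ?X = "{U \<in> extensional A. semistandard A U \<and> lattice_filling A U \<and> has_content A U nu}"
  let ?Y = "{T. LR_tab \<alpha> \<beta> T \<and> content \<alpha> \<beta> T = nu}"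
  \<comment> \<open>Serves both directions of the bijection: with \<open>T = unglue U\<close> for a
    given \<open>U\<close>, and with \<open>U = glue T\<close> for a given \<open>T\<close>.\<close>
  have iff: "semistandard A U \<and> lattice_filling A U \<and> has_content A U nu \<longleftrightarrow>
      LR_tab \<alpha> \<beta> T \<and> content \<alpha> \<beta> T = nu"
    if ext: "T \<in> extensional (young_diagram \<beta>)"
      and UB: "\<And>i j. (i, j) \<in> young_diagram \<alpha> \<Longrightarrow> U (i + a, j + b) = i"
      and UC: "\<And>i j. (i, j) \<in> young_diagram \<beta> \<Longrightarrow> U (i + c, j + d) = T (i, j)" for U T
  proof -
    have "has_content A U nu \<longleftrightarrow> content \<alpha> \<beta> T = nu"
      using card_glue[of U T, OF UB UC, of "\<lambda>_. True"] by (simp add: has_content_def content_def fun_eq_iff)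
    moreover have "semistandard A U \<and> lattice_filling A U \<longleftrightarrow> LR_tab \<alpha> \<beta> T"
      using semistandard_glue_iff[of U T, OF UB UC] glue_rows_iff[of U T, OF UB UC]
        lattice_filling_iff_rows[OF finite_A, of U] ext unfolding LR_tab_def by blast
    ultimately show ?thesis by blast
  qed
  have "bij_betw unglue ?X ?Y"
  proof (rule bij_betw_byWitness[where f' = glue])
    have UC: "U (i + c, j + d) = unglue U (i, j)" if "(i, j) \<in> young_diagram \<beta>" for U i j
      using that by (simp add: unglue_def)
    show "\<forall>U\<in>?X. glue (unglue U) = U"
    proof
      fix U assume U: "U \<in> ?X"
      show "glue (unglue U) = U"
      proof (rule extensionalityI)
        fix z assume z: "z \<in> A"
        obtain x y where xy: "z = (x, y)" by (cases z)
        show "glue (unglue U) z = U z"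
        proof (cases "z \<in> B")
          case True
          then show ?thesis
            using xy glue_B[of "x - a" "y - b"] LR_filling_B[of U "x - a" "y - b"] U by simp
        next
          case False
          then have "z \<in> C" using z by blast
          then show ?thesis
            using xy glue_C[of "x - c" "y - d"] UC[of "x - c" "y - d" U] by simp
        qed
      qed (use U in \<open>auto simp: glue_def\<close>)
    qed
    show "\<forall>T\<in>?Y. unglue (glue T) = T"
    proof
      fix T assume T: "T \<in> ?Y"
      show "unglue (glue T) = T"
      proof (rule extensionalityI)
        fix x assume "x \<in> young_diagram \<beta>"
        then show "unglue (glue T) x = T x" using glue_C by (cases x) (auto simp: unglue_def)
      qed (use T in \<open>auto simp: unglue_def LR_tab_def\<close>)
    qed
    show "unglue ` ?X \<subseteq> ?Y"
    proof (rule image_subsetI)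
      fix U assume U: "U \<in> ?X"
      then have "\<And>i j. (i, j) \<in> young_diagram \<alpha> \<Longrightarrow> U (i + a, j + b) = i" using LR_filling_B by blast
      moreover have "unglue U \<in> extensional (young_diagram \<beta>)" by (simp add: unglue_def)
      ultimately show "unglue U \<in> ?Y" using iff[of "unglue U" U] UC U by blast
    qed
    show "glue ` ?Y \<subseteq> ?X"
    proof (rule image_subsetI)
      fix T assume T: "T \<in> ?Y"
      then have "T \<in> extensional (young_diagram \<beta>)" by (auto simp: LR_tab_def)
      moreover have "glue T \<in> extensional A" by (simp add: glue_def)
      ultimately show "glue T \<in> ?X" using iff[of T "glue T"] glue_B glue_C T by blast
    qed
  qed
  then show ?thesis unfolding LR_coeff_def assms by (rule bij_betw_same_card)
qed

text \<open>A northwest neighbour never lies in the other piece: from \<open>B\<close> it stays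
  above row \<open>c\<close>, from \<open>C\<close> it stays left of column \<open>b\<close>. So the
  ribbon can be found piece by piece.\<close>

lemma nw_ribbon_diag_core:
  "nw_ribbon (shift_set a b (diag_core \<alpha> k) \<union> shift_set c d (diag_core \<beta> k)) =
    shift_set a b (diag_hook \<alpha> k) \<union> shift_set c d (diag_hook \<beta> k)"
    (is "nw_ribbon (?B \<union> ?C) = ?R")
proof -
  have BB: "(x, y) \<in> ?B \<Longrightarrow> (x, y) \<in> B" and CC: "(x, y) \<in> ?C \<Longrightarrow> (x, y) \<in> C" for x y
    by (auto simp: diag_core_def)
  have "(x, y) \<in> nw_ribbon (?B \<union> ?C) \<longleftrightarrow> (x, y) \<in> ?R" for x y
  proof -
    consider (B) "(x, y) \<in> ?B" | (C) "(x, y) \<in> ?C" | (none) "(x, y) \<notin> ?B" "(x, y) \<notin> ?C" by blast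
    then show ?thesis
    proof cases
      case B
      have x: "x < c" using B_row[OF BB[OF B]] by simp
      then have "(x, y) \<notin> C" "(x - 1, y - 1) \<notin> C" using C_row[of x y] C_row[of "x - 1" "y - 1"] by linarith+
      then have "(x, y) \<notin> ?C" "(x - 1, y - 1) \<notin> ?C" using CC by blast+
      moreover have "(x, y) \<notin> shift_set c d (diag_hook \<beta> k)"
        using \<open>(x, y) \<notin> ?C\<close> diag_hook_subset by auto
      ultimately show ?thesis
        using B nw_neighbour_diag_core[OF part_a B] unfolding nw_ribbon_def by blast
    next
      case C
      have y: "y < b" using C_row[OF CC[OF C]] by simp
      then have "(x, y) \<notin> B" "(x - 1, y - 1) \<notin> B" using B_row[of x y] B_row[of "x - 1" "y - 1"] by linarith+
      then have "(x, y) \<notin> ?B" "(x - 1, y - 1) \<notin> ?B" using BB by blast+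
      moreover have "(x, y) \<notin> shift_set a b (diag_hook \<alpha> k)"
        using \<open>(x, y) \<notin> ?B\<close> diag_hook_subset by auto
      ultimately show ?thesis
        using C nw_neighbour_diag_core[OF part_b C] unfolding nw_ribbon_def by blast
    next
      case none
      then show ?thesis using diag_hook_subset by (auto simp: nw_ribbon_def)
    qed
  qed
  then show ?thesis by (metis subsetI subset_antisym surj_pair)
qed

lemma nw_rest_diag_core:
  "nw_rest A k = shift_set a b (diag_core \<alpha> k) \<union> shift_set c d (diag_core \<beta> k)"
proof (induction k)
  case 0
  have "diag_core lam 0 = young_diagram lam" for lam by (auto simp: diag_core_def)
  then show ?case by simp
next
  case (Suc k)
  have "shift_set a b (diag_core \<alpha> k) \<inter> shift_set c d (diag_hook \<beta> k) = {}"
    "shift_set c d (diag_core \<beta> k) \<inter> shift_set a b (diag_hook \<alpha> k) = {}"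
    using B_C_disjoint by (auto simp: diag_core_def diag_hook_def disjoint_iff)
  moreover have "shift_set a b (diag_core lam k) - shift_set a b (diag_hook lam k) = shift_set a b (diag_core lam (Suc k))"
    for lam a b by (auto simp: diag_core_def diag_hook_def)
  ultimately show ?case
    unfolding nw_rest.simps Suc.IH nw_ribbon_diag_core by blast
qed

lemma pi_nw_eq: "pi_nw A = (\<lambda>i. hl \<alpha> i + hl \<beta> i)"
proof
  fix k
  have "shift_set a b (diag_hook \<alpha> k) \<inter> shift_set c d (diag_hook \<beta> k) = {}"
    using B_C_disjoint by (auto simp: diag_hook_def disjoint_iff)
  then show "pi_nw A k = hl \<alpha> k + hl \<beta> k"
    unfolding pi_nw_def nw_rest_diag_core nw_ribbon_diag_core
    by (subst card_Un_disjoint)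
      (simp_all add: finite_shift_set finite_diag_hook part_a part_b card_shift_set card_diag_hook)
qed

lemma hl_skew_two_pieces:
  assumes skew: "skew_diagram lam mu = A"
  shows "hl_skew lam mu = (\<lambda>i. hl \<alpha> i + hl \<beta> i) \<and>
    card {nu. hl nu = hl_skew lam mu \<and> appears_in_skew lam mu nu} = 2 ^ min (durfee \<alpha>) (durfee \<beta>) \<and>
    (\<forall>nu. hl nu = hl_skew lam mu \<and> appears_in_skew lam mu nu \<longrightarrow> LR_coeff lam mu nu = 1)"
proof -
  let ?h = "\<lambda>i. hl \<alpha> i + hl \<beta> i"
  let ?M = "max_tabs \<alpha> \<beta>"
  let ?H = "hl ` {nu. appears_in_skew lam mu nu}"
  let ?Y = "\<lambda>nu. {T. LR_tab \<alpha> \<beta> T \<and> content \<alpha> \<beta> T = nu}"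
  note core = LR_tab_hl_max[OF part_a part_b]
  have appears: "appears_in_skew lam mu nu \<longleftrightarrow> (\<exists>T. LR_tab \<alpha> \<beta> T \<and> content \<alpha> \<beta> T = nu)" for nu
  proof -
    have "finite (?Y nu)" using finite_LR_tab[OF part_a part_b] by (rule rev_finite_subset) blast
    then have "LR_coeff lam mu nu \<noteq> 0 \<longleftrightarrow> ?Y nu \<noteq> {}"
      unfolding LR_coeff_eq_card_LR_tab[OF skew] by (subst card_0_eq) auto
    then show ?thesis
      unfolding appears_in_skew_def using content_partition[OF _ part_a part_b] by blast
  qed
  have "card ?M \<noteq> 0" using core by simp
  then obtain T0 where T0: "T0 \<in> ?M" by (metis all_not_in_conv card.empty)
  have mem: "?h \<in> ?H" using T0 appears unfolding max_tabs_def by (metis (mono_tags, lifting) image_eqI mem_Collect_eq)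
  have max: "h' = ?h \<or> less_fun h' ?h" if "h' \<in> ?H" for h'
  proof -
    obtain T where T: "LR_tab \<alpha> \<beta> T" "h' = hl (content \<alpha> \<beta> T)" using \<open>h' \<in> ?H\<close> by (auto simp: appears)
    then have "T \<in> ?M \<or> less_fun h' ?h" using core by blast
    then show ?thesis using T(2) by (auto simp: max_tabs_def)
  qed
  have hl: "hl_skew lam mu = ?h"
    unfolding hl_skew_def
  proof (rule the_equality)
    show "?h \<in> ?H \<and> (\<forall>h'\<in>?H. h' = ?h \<or> less_fun h' ?h)" using mem max by blast
    fix h assume h: "h \<in> ?H \<and> (\<forall>h'\<in>?H. h' = h \<or> less_fun h' h)"
    \<comment> \<open>Two different maxima would each be below the other, against the asymmetry of
      \<open>less_fun\<close>.\<close>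
    show "h = ?h"
    proof (rule ccontr)
      assume ne: "h \<noteq> ?h"
      have "less_fun h ?h" using max[of h] h ne by simp
      moreover have "less_fun ?h h" using bspec[OF conjunct2[OF h] mem] ne by simp
      ultimately show False by (rule less_fun_asym[THEN notE])
    qed
  qed
  have set_eq: "{nu. hl nu = hl_skew lam mu \<and> appears_in_skew lam mu nu} = content \<alpha> \<beta> ` ?M"
    unfolding hl max_tabs_def by (auto simp: appears)
  have "LR_coeff lam mu nu = 1" if nu: "nu \<in> content \<alpha> \<beta> ` ?M" for nu
  proof -
    obtain T where T: "T \<in> ?M" "nu = content \<alpha> \<beta> T" using nu by blast
    \<comment> \<open>Every filling with content \<open>nu\<close> is again maximal, so the
      injectivity of \<open>content\<close> on \<open>?M\<close> applies.\<close>
    have "?Y nu = {T}"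
    proof (intro equalityI subsetI)
      fix T' assume "T' \<in> ?Y nu"
      then have "T' \<in> ?M" "content \<alpha> \<beta> T' = content \<alpha> \<beta> T" using T by (auto simp: max_tabs_def)
      then show "T' \<in> {T}" using inj_onD[of "content \<alpha> \<beta>" ?M T' T] core T(1) by simp
    qed (use T in \<open>auto simp: max_tabs_def\<close>)
    then show ?thesis using LR_coeff_eq_card_LR_tab[OF skew, of nu] by simp
  qed
  moreover have "card (content \<alpha> \<beta> ` ?M) = 2 ^ min (durfee \<alpha>) (durfee \<beta>)"
    using core card_image[of "content \<alpha> \<beta>" ?M] by simp
  moreover have "nu \<in> content \<alpha> \<beta> ` ?M" if "hl nu = hl_skew lam mu \<and> appears_in_skew lam mu nu" for nu
    using that set_eq by blast
  ultimately show ?thesis unfolding set_eq using hl by blast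
qed

end

text \<open>If \<open>rows\<close> failed, \<open>(c, b)\<close> would belong to the upper piece and
  share a row with the corner \<open>(c, d)\<close>; if \<open>cols\<close> failed, it would belong
  to the lower piece and share a column with \<open>(a, b)\<close>. The second argument needs
  \<open>d < b\<close>, where the skew shape enters.\<close>

lemma two_pieces_of_disconnected:
  assumes lam: "is_partition lam"
    and part: "is_partition \<alpha>" "is_partition \<beta>" and pos: "0 < \<alpha> 0" "0 < \<beta> 0"
    and skew: "skew_diagram lam mu = shift_set a b (young_diagram \<alpha>) \<union> shift_set c d (young_diagram \<beta>)"
    and disc: "disconnected (shift_set a b (young_diagram \<alpha>)) (shift_set c d (young_diagram \<beta>))"
    and less: "a < c"
  shows "two_pieces \<alpha> \<beta> a b c d"
proof
  have disc': False
    if "(x, y) \<in> shift_set a b (young_diagram \<alpha>)" "(x', y') \<in> shift_set c d (young_diagram \<beta>)" "x = x' \<or> y = y'"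
    for x y x' y' using disc that unfolding disconnected_def by blast
  show "a + part_length \<alpha> \<le> c"
  proof (rule ccontr)
    assume "\<not> a + part_length \<alpha> \<le> c"
    then have "0 < \<alpha> (c - a)" using part_length_iff[OF part(1), of "c - a"] less by simp
    then show False using disc'[of c b c d] less pos by simp
  qed
  have ab: "(a, b) \<in> skew_diagram lam mu" and cd: "(c, d) \<in> skew_diagram lam mu"
    unfolding skew using pos by simp_all
  have "d < b"
  proof (rule ccontr)
    assume "\<not> d < b"
    then have "b \<le> d" by simp
    \<comment> \<open>For \<open>b \<le> d\<close> the box \<open>(a, d)\<close> lies in the skew
      diagram, as row \<open>a\<close> of \<open>lam\<close> is at least as long as row
      \<open>c\<close>. Being above row \<open>c\<close> it belongs to the upper piece, yet it
      shares a column with \<open>(c, d)\<close>.\<close>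
    have "mu a \<le> d" using ab \<open>b \<le> d\<close> by (simp add: skew_diagram_def)
    moreover have "d < lam a"
      using cd partition_antimonoD[OF lam, of a c] less by (simp add: skew_diagram_def)
    ultimately have "(a, d) \<in> skew_diagram lam mu" by (simp add: skew_diagram_def)
    then have "(a, d) \<in> shift_set a b (young_diagram \<alpha>)" using less unfolding skew by simp
    then show False using disc'[of a d c d] pos by simp
  qed
  show "d + \<beta> 0 \<le> b"
  proof (rule ccontr)
    assume "\<not> d + \<beta> 0 \<le> b"
    then have "b - d < \<beta> 0" using \<open>d < b\<close> by linarith
    then show False using disc'[of a b c b] \<open>d < b\<close> pos by simp
  qed
qed (fact part)+

theorem theorem3p1:
  fixes lam mu \<alpha> \<beta> :: "nat \<Rightarrow> nat" and B C :: "(nat \<times> nat) set"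
  assumes "is_partition lam" and "is_partition mu"
    and "young_diagram mu \<subseteq> young_diagram lam"
    and "is_partition \<alpha>" and "young_diagram \<alpha> \<noteq> {}"
    and "is_partition \<beta>" and "young_diagram \<beta> \<noteq> {}"
    and "skew_diagram lam mu = B \<union> C"
    and "disconnected B C"
    and "is_translate B (young_diagram \<alpha>)"
    and "is_translate C (young_diagram \<beta>)"
  shows "hl_skew lam mu = (\<lambda>i. hl \<alpha> i + hl \<beta> i) \<and>
    (\<lambda>i. hl \<alpha> i + hl \<beta> i) = pi_nw (skew_diagram lam mu) \<and>
    card {nu. hl nu = hl_skew lam mu \<and> appears_in_skew lam mu nu}
      = 2 ^ min (durfee \<alpha>) (durfee \<beta>) \<and>
    (\<forall>nu. hl nu = hl_skew lam mu \<and> appears_in_skew lam mu nu \<longrightarrow> LR_coeff lam mu nu = 1)"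
proof -
  obtain a b where B: "B = shift_set a b (young_diagram \<alpha>)"
    using assms(10) by (auto simp: is_translate_def shift_set_def)
  obtain c d where C: "C = shift_set c d (young_diagram \<beta>)"
    using assms(11) by (auto simp: is_translate_def shift_set_def)
  have first_row: "0 < lam' 0" if "is_partition lam'" "young_diagram lam' \<noteq> {}" for lam'
  proof -
    obtain i j where "j < lam' i" using \<open>young_diagram lam' \<noteq> {}\<close> by (auto simp: young_diagram_def)
    then show ?thesis using partition_antimonoD[OF \<open>is_partition lam'\<close>, of 0 i] by simp
  qed
  have pos: "0 < \<alpha> 0" "0 < \<beta> 0" using first_row assms(4-7) by auto
  have "(a, b) \<in> B" "(c, d) \<in> C" using B C pos by simp_all
  then have "a \<noteq> c" using assms(9) unfolding disconnected_def by blast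
  \<comment> \<open>Either piece may be the upper one; the claims are symmetric in \<alpha> and
    \<beta>.\<close>
  then consider "a < c" | "c < a" by linarith
  then show ?thesis
  proof cases
    case 1
    interpret two_pieces \<alpha> \<beta> a b c d
      by (rule two_pieces_of_disconnected[OF assms(1,4,6) pos]) (use assms(8,9) B C 1 in simp_all)
    have skew: "skew_diagram lam mu = A" using assms(8) B C by simp
    show ?thesis unfolding skew pi_nw_eq using hl_skew_two_pieces[OF skew] by blast
  next
    case 2
    have "disconnected C B" using assms(9) unfolding disconnected_def by blast
    then interpret two_pieces \<beta> \<alpha> c d a b
      by (intro two_pieces_of_disconnected[OF assms(1,6,4) pos(2,1)])
        (use assms(8) B C 2 in \<open>simp_all add: Un_commute\<close>)
    have skew: "skew_diagram lam mu = A" using assms(8) B C by auto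
    have comm: "(\<lambda>i. hl \<alpha> i + hl \<beta> i) = (\<lambda>i. hl \<beta> i + hl \<alpha> i)"
      "min (durfee \<alpha>) (durfee \<beta>) = min (durfee \<beta>) (durfee \<alpha>)" by (simp_all add: add.commute min.commute)
    show ?thesis unfolding skew pi_nw_eq comm using hl_skew_two_pieces[OF skew] by blast
  qed
qed

end
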